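(* Let $L$ be a slim planar semimodular lattice. Then: (i) $\operatorname{Con} L$ satisfies the forbidden marriage property; and (ii) $\operatorname{Con} L$ satisfies the two-pendant four-crown property.
   Context: Planar lattices are finite by definition: a planar lattice is a finite lattice that has a planar Hasse diagram. Semimodular means upper semimodular. A planar semimodular lattice is called slim if the five-element nondistributive modular lattice $M_3$ is not (isomorphic to) a sublattice of it. $\operatorname{Con} L$ denotes the congruence lattice of $L$ (a finite distributive lattice when $L$ is finite). For a finite distributive lattice $D$, $J(D)$ denotes the poset of nonzero join-irreducible elements of $D$ with the order inherited from $D$, $\prec_{J(D)}$ denotes the covering relation of the poset $J(D)$, and $\operatorname{Max}(J(D))$ is the set of maximal elements of $J(D)$. Forbidden marriage property: $D$ satisfies it if for all $x,y\in J(D)$ and $z\in \operatorname{Max}(J(D))$, if $x\neq y$, $x\prec_{J(D)} z$ and $y\prec_{J(D)} z$, then there is no $p\in J(D)$ such that $p\prec_{J(D)} x$ and $p\prec_{J(D)} y$. A poset $X$ is a cover-preserving subposet of a poset $Y$ if $X\subseteq Y$ and for all $u,v\in X$: $u\leq_X v\iff u\leq_Y v$, and $u\prec_X v\iff u\prec_Y v$. The two-pendant four-crown is the 10-element poset $R=\{a,b,c,d,x,y,u,v,z,w\}$ whose covering pairs are exactly: $x\prec a$, $x\prec b$; $u\prec b$, $u\prec c$; $y\prec c$, $y\prec d$; $v\prec d$, $v\prec a$; $z\prec x$, $z\prec y$; $w\prec u$, $w\prec v$. (Thus $a,b,c,d$ are its maximal elements and $z,w$ its minimal elements.) Two-pendant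 four-crown property: $D$ satisfies it if $J(D)$ has no cover-preserving subposet isomorphic to $R$ such that the (four) maximal elements of this subposet are maximal elements of $J(D)$. *)

theory Defs
  imports "HOL-Analysis.Analysis"
begin

text \<open>
  A finite lattice is a type of class \<open>{finite, lattice}\<close>, passed to predicates as \<open>TYPE('a)\<close>.
  All other posets (lattices of congruences, posets of join-irreducible elements and their
  subposets) are subsets \<open>P\<close> of a type of class \<open>order\<close>, with the order inherited from the type.
\<close>


definition covers_in :: "'a::order set \<Rightarrow> 'a \<Rightarrow> 'a \<Rightarrow> bool" where
  "covers_in P x y \<longleftrightarrow> x \<in> P \<and> y \<in> P \<and> x < y \<and> \<not> (\<exists>z\<in>P. x < z \<and> z < y)"

definition Max_elems :: "'a::order set \<Rightarrow> 'a set" where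
  "Max_elems P = {z \<in> P. \<not> (\<exists>y\<in>P. z < y)}"

definition poset_iso :: "('a::order \<Rightarrow> 'b::order) \<Rightarrow> 'a set \<Rightarrow> 'b set \<Rightarrow> bool" where
  "poset_iso f P Q \<longleftrightarrow> bij_betw f P Q \<and> (\<forall>x\<in>P. \<forall>y\<in>P. x \<le> y \<longleftrightarrow> f x \<le> f y)"

text \<open>The condition on \<open>\<le>\<close> holds automatically, since \<open>X\<close> and \<open>Y\<close> inherit the same order.\<close>

definition cover_preserving_subposet :: "'a::order set \<Rightarrow> 'a set \<Rightarrow> bool" where
  "cover_preserving_subposet X Y \<longleftrightarrow>
     X \<subseteq> Y \<and> (\<forall>u\<in>X. \<forall>v\<in>X. covers_in X u v \<longleftrightarrow> covers_in Y u v)"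


text \<open>
  Edges of a Hasse diagram are straight line segments going upwards; the diagram is planar if two
  different edges meet at most in a common endpoint.
\<close>

definition hasse_diagram :: "('a::{finite,lattice} \<Rightarrow> real \<times> real) \<Rightarrow> bool" where
  "hasse_diagram pos \<longleftrightarrow>
     inj pos \<and>
     (\<forall>x y. x < y \<longrightarrow> snd (pos x) < snd (pos y)) \<and>
     (\<forall>x y z. covers_in UNIV x y \<and> pos z \<in> closed_segment (pos x) (pos y) \<longrightarrow> z = x \<or> z = y)"

definition planar_hasse_diagram :: "('a::{finite,lattice} \<Rightarrow> real \<times> real) \<Rightarrow> bool" where
  "planar_hasse_diagram pos \<longleftrightarrow>
     hasse_diagram pos \<and>
     (\<forall>x y x' y'. covers_in UNIV x y \<and> covers_in UNIV x' y' \<and> (x, y) \<noteq> (x', y') \<longrightarrow>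
        closed_segment (pos x) (pos y) \<inter> closed_segment (pos x') (pos y')
          \<subseteq> {pos x, pos y} \<inter> {pos x', pos y'})"

definition planar_lattice :: "'a::{finite,lattice} itself \<Rightarrow> bool" where
  "planar_lattice L \<longleftrightarrow> (\<exists>pos :: 'a \<Rightarrow> real \<times> real. planar_hasse_diagram pos)"

definition semimodular :: "'a::lattice itself \<Rightarrow> bool" where
  "semimodular L \<longleftrightarrow>
     (\<forall>x y z :: 'a. covers_in UNIV x y \<longrightarrow>
        sup x z = sup y z \<or> covers_in UNIV (sup x z) (sup y z))"

datatype M3 = M3_bot | M3_a | M3_b | M3_c | M3_top

instantiation M3 :: lattice
begin

definition less_eq_M3 :: "M3 \<Rightarrow> M3 \<Rightarrow> bool" where
  "x \<le> y \<longleftrightarrow> x = M3_bot \<or> y = M3_top \<or> x = y"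

definition less_M3 :: "M3 \<Rightarrow> M3 \<Rightarrow> bool" where
  "x < y \<longleftrightarrow> x \<le> y \<and> x \<noteq> (y::M3)"

definition sup_M3 :: "M3 \<Rightarrow> M3 \<Rightarrow> M3" where
  "sup x y = (if x \<le> y then y else if y \<le> x then x else M3_top)"

definition inf_M3 :: "M3 \<Rightarrow> M3 \<Rightarrow> M3" where
  "inf x y = (if x \<le> y then x else if y \<le> x then y else M3_bot)"

instance
  by standard (auto simp: less_eq_M3_def less_M3_def sup_M3_def inf_M3_def)

end

definition sublattice :: "'a::lattice set \<Rightarrow> bool" where
  "sublattice S \<longleftrightarrow> S \<noteq> {} \<and> (\<forall>x\<in>S. \<forall>y\<in>S. sup x y \<in> S \<and> inf x y \<in> S)"

definition lattice_iso_on :: "('a::lattice \<Rightarrow> 'b::lattice) \<Rightarrow> 'a set \<Rightarrow> 'b set \<Rightarrow> bool" where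
  "lattice_iso_on f A B \<longleftrightarrow>
     bij_betw f A B \<and>
     (\<forall>x\<in>A. \<forall>y\<in>A. f (sup x y) = sup (f x) (f y) \<and> f (inf x y) = inf (f x) (f y))"

definition slim :: "'a::lattice itself \<Rightarrow> bool" where
  "slim L \<longleftrightarrow>
     \<not> (\<exists>S :: 'a set. sublattice S \<and> (\<exists>f :: M3 \<Rightarrow> 'a. lattice_iso_on f UNIV S))"


definition lattice_congruence :: "('a::lattice \<times> 'a) set \<Rightarrow> bool" where
  "lattice_congruence \<theta> \<longleftrightarrow>
     equiv UNIV \<theta> \<and>
     (\<forall>a b c d. (a, b) \<in> \<theta> \<and> (c, d) \<in> \<theta> \<longrightarrow>
        (sup a c, sup b d) \<in> \<theta> \<and> (inf a c, inf b d) \<in> \<theta>)"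

text \<open>Congruences are ordered by inclusion, which is the order of the type of sets of pairs.\<close>

definition Con :: "'a::lattice itself \<Rightarrow> ('a \<times> 'a) set set" where
  "Con L = {\<theta>. lattice_congruence \<theta>}"

text \<open>
  Joins are taken in \<open>D\<close> and not in the ambient type: the join of two congruences is in general
  not their union.
\<close>

definition is_join_in :: "'a::order set \<Rightarrow> 'a \<Rightarrow> 'a \<Rightarrow> 'a \<Rightarrow> bool" where
  "is_join_in D a b s \<longleftrightarrow>
     s \<in> D \<and> a \<le> s \<and> b \<le> s \<and> (\<forall>t\<in>D. a \<le> t \<and> b \<le> t \<longrightarrow> s \<le> t)"

definition is_zero_in :: "'a::order set \<Rightarrow> 'a \<Rightarrow> bool" where
  "is_zero_in D x \<longleftrightarrow> x \<in> D \<and> (\<forall>y\<in>D. x \<le> y)"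

definition J :: "'a::order set \<Rightarrow> 'a set" where
  "J D = {x \<in> D. \<not> is_zero_in D x \<and>
                 (\<forall>a\<in>D. \<forall>b\<in>D. is_join_in D a b x \<longrightarrow> x = a \<or> x = b)}"


definition forbidden_marriage_property :: "'a::order set \<Rightarrow> bool" where
  "forbidden_marriage_property D \<longleftrightarrow>
     (\<forall>x\<in>J D. \<forall>y\<in>J D. \<forall>z\<in>Max_elems (J D).
        x \<noteq> y \<and> covers_in (J D) x z \<and> covers_in (J D) y z \<longrightarrow>
        \<not> (\<exists>p\<in>J D. covers_in (J D) p x \<and> covers_in (J D) p y))"

datatype R = R_a | R_b | R_c | R_d | R_x | R_y | R_u | R_v | R_z | R_w

definition R_edges :: "(R \<times> R) set" where
  "R_edges = {(R_x, R_a), (R_x, R_b), (R_u, R_b), (R_u, R_c), (R_y, R_c), (R_y, R_d),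
              (R_v, R_d), (R_v, R_a), (R_z, R_x), (R_z, R_y), (R_w, R_u), (R_w, R_v)}"

fun R_height :: "R \<Rightarrow> nat" where
  "R_height R_z = 0" | "R_height R_w = 0"
| "R_height R_x = 1" | "R_height R_y = 1" | "R_height R_u = 1" | "R_height R_v = 1"
| "R_height R_a = 2" | "R_height R_b = 2" | "R_height R_c = 2" | "R_height R_d = 2"

lemma R_edges_height: "(p, q) \<in> R_edges \<Longrightarrow> R_height q = Suc (R_height p)"
  by (auto simp: R_edges_def)

lemma R_edges_rtrancl_height: "(p, q) \<in> R_edges\<^sup>* \<Longrightarrow> p = q \<or> R_height p < R_height q"
  by (induction rule: rtrancl_induct) (auto dest: R_edges_height)

instantiation R :: order
begin

definition less_eq_R :: "R \<Rightarrow> R \<Rightarrow> bool" where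
  "p \<le> q \<longleftrightarrow> (p, q) \<in> R_edges\<^sup>*"

definition less_R :: "R \<Rightarrow> R \<Rightarrow> bool" where
  "p < q \<longleftrightarrow> p \<le> q \<and> p \<noteq> (q::R)"

instance
proof
  fix p q r :: R
  show antisym: "p = q" if "p \<le> q" "q \<le> p"
    using that R_edges_rtrancl_height[of p q] R_edges_rtrancl_height[of q p]
    by (auto simp: less_eq_R_def)
  show "p < q \<longleftrightarrow> p \<le> q \<and> \<not> q \<le> p"
    using R_edges_rtrancl_height[of p q] R_edges_rtrancl_height[of q p]
    by (auto simp: less_eq_R_def less_R_def)
qed (auto simp: less_eq_R_def)

end

lemma R_less_height: "p < q \<Longrightarrow> R_height p < R_height q"
  using R_edges_rtrancl_height by (auto simp: less_R_def less_eq_R_def)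

text \<open>The given pairs are exactly the covering pairs of the order they generate.\<close>

lemma R_covers_iff: "covers_in UNIV p q \<longleftrightarrow> (p, q) \<in> R_edges"
proof
  assume cov: "covers_in UNIV p q"
  then have "(p, q) \<in> R_edges\<^sup>*" "p \<noteq> q"
    by (auto simp: covers_in_def less_R_def less_eq_R_def)
  then obtain r where r: "(p, r) \<in> R_edges" "(r, q) \<in> R_edges\<^sup>*"
    by (meson converse_rtranclE)
  then have "p < r"
    using R_edges_height by (fastforce simp: less_R_def less_eq_R_def)
  moreover have "r \<le> q"
    using r by (simp add: less_eq_R_def)
  ultimately have "r = q"
    using cov by (auto simp: covers_in_def order.order_iff_strict)
  with r show "(p, q) \<in> R_edges" by simp
next
  assume e: "(p, q) \<in> R_edges"
  then have "p < q"
    using R_edges_height by (fastforce simp: less_R_def less_eq_R_def)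
  moreover have False if "p < r" "r < q" for r
    using R_edges_height[OF e] R_less_height[OF that(1)] R_less_height[OF that(2)] by simp
  ultimately show "covers_in UNIV p q"
    by (auto simp: covers_in_def)
qed

definition two_pendant_four_crown_property :: "'a::order set \<Rightarrow> bool" where
  "two_pendant_four_crown_property D \<longleftrightarrow>
     \<not> (\<exists>X. cover_preserving_subposet X (J D) \<and>
            (\<exists>f :: R \<Rightarrow> 'a. poset_iso f UNIV X) \<and>
            Max_elems X \<subseteq> Max_elems (J D))"

end

theory Submission
  imports Defs
begin

text \<open>
  In a planar diagram the upper covers of an element are ordered by slope; in a slim semimodular
  lattice only the leftmost cover \<open>l x\<close> and the rightmost cover \<open>r x\<close> remain. The two maximal chains
  obtained by iterating \<open>l\<close> and \<open>r\<close> from the bottom generate the lattice under joins, so counting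
  chain elements below \<open>x\<close> gives coordinates \<open>i x\<close>, \<open>j x\<close> which embed the lattice in a grid,
  preserving meets, and which are injective on meet-irreducible elements.

  A congruence is determined by the meet-irreducible elements that it identifies with their upper
  cover. Say that \<open>e\<close> lies under \<open>m\<close> if \<open>e\<close> has meet-irreducibles both on its north-west and on its
  south-east side, \<open>m\<close> is incomparable to \<open>e\<close>, and every meet-irreducible above \<open>m\<close> is above \<open>e\<close>.
  The sets arising from congruences are exactly those closed under passing from \<open>m\<close> to \<open>e\<close>, so
  the join-irreducible congruences form the poset associated with the reflexive transitive closure of
  this relation. Its maximal elements lie on the boundary of the grid, and two different
  covers of an element always sit on opposite sides of it; both properties then follow by comparing
  coordinates.
\<close>

section \<open>Left and right upper covers from a planar diagram\<close>

abbreviation covers :: "'a::order \<Rightarrow> 'a \<Rightarrow> bool" where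
  "covers \<equiv> covers_in UNIV"

lemma coversD: "covers x y \<Longrightarrow> x < y"
  by (simp add: covers_in_def)

lemma covers_between: "covers x y \<Longrightarrow> x \<le> z \<Longrightarrow> z \<le> y \<Longrightarrow> z = x \<or> z = y"
  by (auto simp: covers_in_def order.order_iff_strict)

lemma covers_incomparable: "covers x y \<Longrightarrow> covers x z \<Longrightarrow> y \<le> z \<Longrightarrow> y = z"
  by (auto simp: covers_in_def order.order_iff_strict)

lemma ex_cover_below:
  fixes x :: "'a::{finite,order}"
  assumes "x < y"
  obtains z where "covers x z" "z \<le> y"
proof -
  obtain z where z: "z \<in> {z. x < z \<and> z \<le> y}" "\<forall>w \<in> {z. x < z \<and> z \<le> y}. w \<le> z \<longrightarrow> z = w"
    using finite_has_minimal[of "{z. x < z \<and> z \<le> y}"] assms by auto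
  then have "covers x z"
    by (fastforce simp: covers_in_def)
  with z show ?thesis using that by auto
qed

lemma ex_cover_above:
  fixes x :: "'a::{finite,order}"
  assumes "x < y"
  obtains z where "covers z y" "x \<le> z"
proof -
  obtain z where z: "z \<in> {z. x \<le> z \<and> z < y}" "\<forall>w \<in> {z. x \<le> z \<and> z < y}. z \<le> w \<longrightarrow> z = w"
    using finite_has_maximal[of "{z. x \<le> z \<and> z < y}"] assms by auto
  then have "covers z y"
    by (auto simp: covers_in_def) (metis order.trans less_imp_le less_irrefl)
  with z show ?thesis using that by auto
qed

lemma finite_greater_induct [case_names greater]:
  fixes x :: "'a::{finite,order}"
  assumes "\<And>x. (\<And>y. x < y \<Longrightarrow> P y) \<Longrightarrow> P x"
  shows "P x"
proof (induction "card {x..}" arbitrary: x rule: less_induct)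
  case less
  show ?case
  proof (rule assms)
    fix y assume "x < y"
    then have "{y..} \<subset> {x..}" by auto
    then show "P y" using less psubset_card_mono by (metis finite)
  qed
qed

lemma finite_less_induct [case_names less]:
  fixes x :: "'a::{finite,order}"
  assumes "\<And>x. (\<And>y. y < x \<Longrightarrow> P y) \<Longrightarrow> P x"
  shows "P x"
proof (induction "card {..x}" arbitrary: x rule: less_induct)
  case less
  show ?case
  proof (rule assms)
    fix y assume "y < x"
    then have "{..y} \<subset> {..x}" by auto
    then show "P y" using less psubset_card_mono by (metis finite)
  qed
qed

lemma semimodularD:
  assumes "semimodular TYPE('a::lattice)" "covers x (y::'a)" "x \<le> z" "\<not> y \<le> z"
  shows "covers z (sup z y)"
  using assms unfolding semimodular_def by (metis sup.absorb2 sup.commute sup.orderI)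

section \<open>Geometry of four-element cells in a planar diagram\<close>

locale planar_diagram =
  fixes pos :: "'a::{finite,lattice} \<Rightarrow> real \<times> real"
  assumes planar: "planar_hasse_diagram pos"
begin

abbreviation "X v \<equiv> fst (pos v)"
abbreviation "Y v \<equiv> snd (pos v)"

text \<open>The reciprocal of the usual slope: heights increase strictly along the order, so
  vertical edges are harmless and smaller values mean further left.\<close>

definition slope :: "'a \<Rightarrow> 'a \<Rightarrow> real" where
  "slope p q = (X q - X p) / (Y q - Y p)"

definition line :: "'a \<Rightarrow> 'a \<Rightarrow> real \<Rightarrow> real" where
  "line p q t = X p + (t - Y p) * slope p q"

lemma Y_less: "p < q \<Longrightarrow> Y p < Y q"
  using planar by (auto simp: planar_hasse_diagram_def hasse_diagram_def)

lemma pos_inj: "pos p = pos q \<Longrightarrow> p = q"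
  using planar by (auto simp: planar_hasse_diagram_def hasse_diagram_def inj_def)

lemma edges_meet:
  assumes "covers x y" "covers x' y'" "(x, y) \<noteq> (x', y')"
    "p \<in> closed_segment (pos x) (pos y)" "p \<in> closed_segment (pos x') (pos y')"
  shows "\<exists>v. p = pos v \<and> (v = x \<or> v = y) \<and> (v = x' \<or> v = y')"
  using planar assms pos_inj unfolding planar_hasse_diagram_def by blast

lemma line_0 [simp]: "line p q (Y p) = X p"
  by (simp add: line_def)

lemma line_1: "p < q \<Longrightarrow> line p q (Y q) = X q"
  using Y_less[of p q] by (simp add: line_def slope_def)

lemma line_segment:
  assumes "p < q" "Y p \<le> t" "t \<le> Y q"
  shows "(line p q t, t) \<in> closed_segment (pos p) (pos q)"
proof -
  have Y: "Y p < Y q" using Y_less assms by auto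
  define u where "u = (t - Y p) / (Y q - Y p)"
  have u: "0 \<le> u" "u \<le> 1" using assms Y by (auto simp: u_def)
  have "u * (Y q - Y p) = t - Y p"
    using Y by (simp add: u_def)
  then have 1: "t = (1 - u) * Y p + u * Y q"
    by (simp add: algebra_simps)
  have "line p q t = X p + u * (X q - X p)"
    by (simp add: u_def line_def slope_def)
  also have "\<dots> = (1 - u) * X p + u * X q"
    by (simp add: algebra_simps)
  finally have "line p q t = (1 - u) * X p + u * X q" .
  then have "(line p q t, t) = (1 - u) *\<^sub>R pos p + u *\<^sub>R pos q"
    using 1 by (simp add: prod_eq_iff)
  then show ?thesis using u by (auto simp: in_segment)
qed

lemma continuous_line: "continuous_on S (line p q)"
  unfolding line_def by (intro continuous_intros)

text \<open>Of two edges leaving \<open>p\<close> in the same direction, the lower one would end on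
  the other, but no element lies inside an edge.\<close>

lemma slope_inj:
  assumes "covers p q" "covers p q'" "slope p q = slope p q'"
  shows "q = q'"
proof -
  have *: "q = q'" if "covers p q" "covers p q'" "slope p q = slope p q'" "Y q \<le> Y q'" for q q'
  proof -
    have "line p q (Y q) = line p q' (Y q)" using that by (simp add: line_def)
    then have "pos q = (line p q' (Y q), Y q)"
      using line_1 coversD[OF that(1)] by (metis prod.collapse)
    then have "pos q \<in> closed_segment (pos p) (pos q')"
      using line_segment[of p q' "Y q"] coversD that Y_less
      by (metis order.strict_implies_order)
    then show ?thesis
      using planar that coversD[OF that(1)]
      unfolding planar_hasse_diagram_def hasse_diagram_def by blast
  qed
  show ?thesis using *[of q q'] *[of q' q] assms by (cases "Y q \<le> Y q'") auto
qed

text \<open>The broken line from \<open>p\<close> through \<open>a\<close> to \<open>c\<close>, as a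
  graph over the height; two such sides bound \<open>region\<close>.\<close>

definition side :: "'a \<Rightarrow> 'a \<Rightarrow> 'a \<Rightarrow> real \<Rightarrow> real" where
  "side p a c t = (if t \<le> Y a then line p a t else line a c t)"

lemma continuous_side:
  assumes "p < a"
  shows "continuous_on S (side p a c)"
proof -
  have "continuous_on UNIV (\<lambda>t. if t \<le> Y a then line p a t else line a c t)"
    by (rule continuous_on_cases_le) (auto intro: continuous_line continuous_intros simp: line_1[OF assms])
  then show ?thesis unfolding side_def[abs_def] by (rule continuous_on_subset) simp
qed

definition region :: "'a \<Rightarrow> 'a \<Rightarrow> 'a \<Rightarrow> 'a \<Rightarrow> (real \<times> real) set" where
  "region p a b c =
     {z. Y p < snd z \<and> snd z < Y c \<and> side p a c (snd z) < fst z \<and> fst z < side p b c (snd z)}"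

lemma side_ends:
  assumes "p < a" "a < c"
  shows "side p a c (Y p) = X p" "side p a c (Y c) = X c"
  using assms Y_less[of p a] Y_less[of a c] by (auto simp: side_def line_1)

lemma side_segment:
  assumes "p < a" "a < c" "Y p \<le> t" "t \<le> Y c"
  shows "(side p a c t, t) \<in> closed_segment (pos p) (pos a) \<union> closed_segment (pos a) (pos c)"
  using assms line_segment[of p a t] line_segment[of a c t] by (auto simp: side_def)

lemma open_region:
  assumes "p < a" "p < b"
  shows "open (region p a b c)"
proof -
  have "continuous_on UNIV (\<lambda>z. side p a c (snd z))" if "p < a" for a
    by (rule continuous_on_compose2[OF continuous_side[OF that, of UNIV]]) (auto intro: continuous_intros)
  then show ?thesis
    unfolding region_def using assms
    by (intro open_Collect_conj open_Collect_less continuous_intros) auto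
qed

text \<open>Weakening the four strict inequalities gives a closed set, so at a frontier point one of
  them is an equality; at the heights of \<open>p\<close> and \<open>c\<close> the two sides
  meet.\<close>

lemma frontier_region:
  assumes "p < a" "p < b" "a < c" "b < c" "z \<in> frontier (region p a b c)"
  shows "z \<in> closed_segment (pos p) (pos a) \<union> closed_segment (pos a) (pos c) \<union>
             closed_segment (pos p) (pos b) \<union> closed_segment (pos b) (pos c)"
proof -
  have cont: "continuous_on UNIV (\<lambda>z. side p a c (snd z))" if "p < a" for a
    by (rule continuous_on_compose2[OF continuous_side[OF that, of UNIV]]) (auto intro: continuous_intros)
  let ?K = "{z. Y p \<le> snd z \<and> snd z \<le> Y c \<and> side p a c (snd z) \<le> fst z \<and> fst z \<le> side p b c (snd z)}"
  have "closed ?K"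
    using cont assms by (intro closed_Collect_conj closed_Collect_le continuous_intros) auto
  then have "closure (region p a b c) \<subseteq> ?K"
    by (intro closure_minimal) (auto simp: region_def)
  then have K: "z \<in> ?K" and n: "z \<notin> region p a b c"
    using assms open_region[of p a b c] by (auto simp: frontier_def interior_open)
  have "fst z = side p a c (snd z) \<or> fst z = side p b c (snd z)"
    using K n side_ends[of p a c] side_ends[of p b c] assms
    by (auto simp: region_def)
  then have "z = (side p a c (snd z), snd z) \<or> z = (side p b c (snd z), snd z)"
    by (metis prod.collapse)
  then show ?thesis
    using side_segment[of p a c "snd z"] side_segment[of p b c "snd z"] assms K by auto
qed


text \<open>By planarity an edge meets the boundary of the cell only in a common endpoint. Its top
  \<open>d\<close> is no corner, as no corner fails to be below \<open>c\<close>, so only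
  \<open>e\<close> is left.\<close>

lemma edge_stays_in_region:
  assumes "covers p a" "covers p b" "covers a c" "covers b c"
    and "covers e d" "\<not> d \<le> c"
    and "z \<in> region p a b c" "z \<in> closed_segment (pos e) (pos d)"
  shows "pos d \<in> region p a b c"
proof (rule ccontr)
  assume d: "pos d \<notin> region p a b c"
  have less: "p < a" "p < b" "a < c" "b < c" using assms by (auto dest: coversD)
  have "closed_segment z (pos d) \<inter> frontier (region p a b c) \<noteq> {}"
    using assms(7) d by (intro connected_Int_frontier) auto
  then obtain q where q: "q \<in> closed_segment z (pos d)" "q \<in> frontier (region p a b c)"
    by auto
  have qe: "q \<in> closed_segment (pos e) (pos d)"
    using q(1) assms(8) by (meson ends_in_segment(2) subset_closed_segment subsetD)
  have d': "d \<noteq> p" "d \<noteq> a" "d \<noteq> b" "d \<noteq> c" using assms(6) less by auto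
  have "\<exists>v. q = pos v \<and> (v = e \<or> v = d) \<and> v \<in> {p, a, b, c}"
    using frontier_region[OF less(1,2,3,4) q(2)] d'
      edges_meet[OF assms(5,1) _ qe] edges_meet[OF assms(5,2) _ qe]
      edges_meet[OF assms(5,3) _ qe] edges_meet[OF assms(5,4) _ qe]
    by blast
  with d' have "q = pos e" by auto
  with q(1) assms(8) have "q = z"
    by (metis between_antisym between_mem_segment)
  with q assms(7) open_region[OF less(1,2)] show False
    by (metis disjoint_iff frontier_disjoint_eq)
qed

text \<open>
  A path going up from \<open>d\<close> stays in the region, as it could leave it only through an element below \<open>c\<close>;
  but \<open>sup d c\<close> lies too high for that.
\<close>

lemma no_escape:
  assumes "covers p a" "covers p b" "covers a c" "covers b c"
    and "covers e d" "\<not> d \<le> c"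
    and "z \<in> region p a b c" "z \<in> closed_segment (pos e) (pos d)"
  shows False
proof -
  have "pos v \<in> region p a b c" if "d \<le> v" for v
    using that
  proof (induction v rule: finite_less_induct)
    case (less v)
    show ?case
    proof (cases "d = v")
      case True
      then show ?thesis using edge_stays_in_region assms by blast
    next
      case False
      with less.prems obtain w where w: "covers w v" "d \<le> w"
        by (metis ex_cover_above order.order_iff_strict)
      have "\<not> v \<le> c" using less.prems assms(6) by auto
      then show ?thesis
        using edge_stays_in_region[OF assms(1-4) w(1), of "pos w"] less.IH[of w] w
        by (auto dest: coversD)
    qed
  qed
  from this[of "sup d c"] have "Y (sup d c) < Y c" by (auto simp: region_def)
  moreover have "c < sup d c" using assms(6) by (simp add: less_le_not_le)
  ultimately show False using Y_less by fastforce
qed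

lemma line_less:
  assumes "slope p a < slope p b" "Y p < t"
  shows "line p a t < line p b t"
  using assms by (simp add: line_def)

text \<open>An edge from \<open>p\<close> strictly between the two lower edges of the cell starts
  inside it, so \<open>no_escape\<close> applies.\<close>

lemma no_cover_between:
  assumes "covers p a" "covers p b" "covers a c" "covers b c" "covers p d" "\<not> d \<le> c"
    and "slope p a < slope p d" "slope p d < slope p b"
  shows False
proof -
  define t where "t = Min {Y a, Y b, Y d}"
  have t: "Y p < t" "t \<le> Y a" "t \<le> Y b" "t \<le> Y d"
    using assms coversD Y_less by (auto simp: t_def)
  have "t < Y c" using t assms coversD Y_less by fastforce
  then have "(line p d t, t) \<in> region p a b c"
    using t assms line_less by (auto simp: region_def side_def)
  then show False
    using no_escape[OF assms(1-6)] line_segment[of p d t] t coversD[OF assms(5)] by auto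
qed

text \<open>An edge from \<open>a\<close> leaning further right than the edge to \<open>c\<close>
  would enter the cell just above \<open>a\<close>.\<close>

lemma upper_cover_leftmost:
  assumes "covers p a" "covers p b" "covers a c" "covers b c" "slope p a < slope p b"
    and "covers a d" "\<not> d \<le> c"
  shows "slope a d \<le> slope a c"
proof (rule ccontr)
  assume sl: "\<not> slope a d \<le> slope a c"
  have less: "p < a" "p < b" "a < c" "b < c" "a < d" using assms by (auto dest: coversD)
  note Y = less[THEN Y_less]
  \<comment> \<open>The sides start in the right order above \<open>p\<close>. If the order failed
    at the height of \<open>a\<close>, they would have met before, and planarity allows this only at
    \<open>p\<close>.\<close>
  have "side p a c (Y a) < side p b c (Y a)"
  proof (rule ccontr)
    assume *: "\<not> ?thesis"
    define t where "t = min (Y a) (Y b)"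
    have t: "Y p < t" "t \<le> Y a" "t \<le> Y b" using Y by (auto simp: t_def)
    then have "side p a c t < side p b c t"
      using assms line_less by (auto simp: side_def)
    then obtain s where s: "t \<le> s" "s \<le> Y a" "side p b c s - side p a c s = 0"
      using IVT2'[of "\<lambda>s. side p b c s - side p a c s" "Y a" 0 t] * t less
      by (auto intro!: continuous_intros continuous_side)
    have s1: "(line p a s, s) \<in> closed_segment (pos p) (pos a)"
      using s t less line_segment by auto
    have "(line p a s, s) \<in> closed_segment (pos p) (pos b) \<union> closed_segment (pos b) (pos c)"
      using s t Y side_segment[of p b c s] less by (auto simp: side_def)
    then have "\<exists>v. (line p a s, s) = pos v \<and> (v = p \<or> v = a) \<and> (v = b \<or> v = p \<or> v = c)"
      using edges_meet[OF assms(1,2) _ s1] edges_meet[OF assms(1,4) _ s1] assms(5) less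
      by (auto)
    then have "s = Y p"
      using less assms(5) by (auto simp: prod_eq_iff)
    with s t show False by auto
  qed
  then have 0: "X a < side p b c (Y a)" using side_def less by (simp add: line_1)
  \<comment> \<open>The inequality at \<open>a\<close> is strict, so by continuity the edge to
    \<open>d\<close> stays left of the right side for a while.\<close>
  have "continuous (at (Y a)) (\<lambda>t. side p b c t - line a d t)"
    using less continuous_side[of p b UNIV c] continuous_line[of UNIV a d]
    by (intro continuous_intros) (auto simp: continuous_on_eq_continuous_at)
  then have "\<forall>\<^sub>F t in at (Y a). 0 < side p b c t - line a d t"
    using 0 by (intro order_tendstoD(1)) (auto simp: isCont_def)
  then have "\<forall>\<^sub>F t in at_right (Y a). line a d t < side p b c t"
    by (simp add: eventually_at_split)
  moreover have "\<forall>\<^sub>F t in at_right (Y a). t \<in> {Y a<..<min (Y c) (Y d)}"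
    using Y by (intro eventually_at_right_real) auto
  ultimately have "\<forall>\<^sub>F t in at_right (Y a). line a d t < side p b c t \<and> t \<in> {Y a<..<min (Y c) (Y d)}"
    by (rule eventually_conj)
  then obtain t where t: "line a d t < side p b c t" "Y a < t" "t < Y c" "t < Y d"
    using eventually_happens'[OF trivial_limit_at_right_real] by fastforce
  then have "(line a d t, t) \<in> region p a b c"
    using Y sl line_less[of a c d t] by (auto simp: region_def side_def)
  then show False
    using no_escape[OF assms(1-4,6,7)] line_segment[of a d t] t less by auto
qed

end

section \<open>Order-theoretic form of planarity and slimness\<close>

lemma planar_diagram_mirror:
  assumes "planar_diagram pos"
  shows "planar_diagram (\<lambda>v. (- fst (pos v), snd (pos v)))"
proof -
  interpret planar_diagram pos by fact
  define h :: "real \<times> real \<Rightarrow> real \<times> real" where "h = (\<lambda>z. (- fst z, snd z))"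
  have "linear h" by (auto simp: h_def intro!: linearI)
  moreover have inj: "inj h" by (auto simp: h_def inj_def prod_eq_iff)
  ultimately have seg: "closed_segment (h u) (h v) = h ` closed_segment u v" for u v
    by (simp add: closed_segment_linear_image)
  have "hasse_diagram (\<lambda>v. h (pos v))"
    using planar inj unfolding planar_hasse_diagram_def hasse_diagram_def seg
    by (auto simp: inj_image_mem_iff inj_eq) (auto simp: inj_def h_def prod_eq_iff)
  then have "planar_hasse_diagram (\<lambda>v. h (pos v))"
    using planar inj unfolding planar_hasse_diagram_def seg
    by (auto simp: inj_eq image_iff) blast+
  then show ?thesis by (simp add: planar_diagram_def h_def)
qed

text \<open>This interface replaces the geometry from here on. \<open>r_l\<close> and
  \<open>l_r\<close> record that no edge starts at a lateral corner of a cell into its interior. At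
  the top both maps are the identity, so that iterating them becomes stationary.\<close>

locale left_right =
  fixes l r :: "'a::{finite,lattice} \<Rightarrow> 'a"
  assumes covers_l: "x < y \<Longrightarrow> covers x (l x)"
    and covers_r: "x < y \<Longrightarrow> covers x (r x)"
    and covers_cases: "covers x y \<Longrightarrow> y = l x \<or> y = r x"
    and r_l: "l x \<noteq> r x \<Longrightarrow> r (l x) = sup (l x) (r x)"
    and l_r: "l x \<noteq> r x \<Longrightarrow> l (r x) = sup (l x) (r x)"
    and top_l: "\<not> (\<exists>y. x < y) \<Longrightarrow> l x = x"
    and top_r: "\<not> (\<exists>y. x < y) \<Longrightarrow> r x = x"
    and semimod: "semimodular TYPE('a)"

lemma covers_sup:
  assumes "semimodular TYPE('a::lattice)" "covers p (a::'a)" "covers p b" "a \<noteq> b"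
  shows "covers a (sup a b)"
  using semimodularD[OF assms(1,3), of a] coversD[OF assms(2)] assms(4)
    covers_incomparable[OF assms(3,2)]
  by (auto simp: less_imp_le)

text \<open>Otherwise \<open>p\<close>, \<open>a\<close>, \<open>b\<close>, \<open>d\<close> and
  \<open>sup a b\<close> form a copy of \<open>M3\<close>: by semimodularity \<open>sup a b\<close>
  covers \<open>a\<close> and \<open>b\<close>, so all three pairwise joins coincide.\<close>

lemma slim_join_of_covers:
  assumes "semimodular TYPE('a::lattice)" "slim TYPE('a)"
    "covers p (a::'a)" "covers p b" "covers p d" "a \<noteq> b" "a \<noteq> d" "b \<noteq> d"
  shows "\<not> d \<le> sup a b"
proof
  assume d: "d \<le> sup a b"
  have less: "p \<le> a" "p \<le> b" "p \<le> d" using assms by (auto dest: coversD)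
  have nle: "\<not> u \<le> v" if "covers p u" "covers p v" "u \<noteq> v" for u v
    using that covers_incomparable by blast
  have inf: "inf u v = p" if "covers p u" "covers p v" "u \<noteq> v" for u v
    using covers_between[OF that(1), of "inf u v"] nle[OF that] coversD that
    by (metis inf.cobounded1 inf.orderI le_inf_iff less_imp_le)
  have "sup a d \<le> sup a b" "sup b d \<le> sup a b"
    using d by simp_all
  moreover have "sup a d \<noteq> a" "sup b d \<noteq> b"
    using nle[of d a] nle[of d b] assms(3-) by (metis sup.cobounded2)+
  ultimately have sup: "sup a d = sup a b" "sup b d = sup a b"
    using covers_between[OF covers_sup[OF assms(1,3,4,6)], of "sup a d"]
      covers_between[OF covers_sup[OF assms(1,4,3)], of "sup b d"] assms(6)
    by (auto simp: sup.commute)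
  define f where "f = case_M3 p a b d (sup a b)"
  have ne: "p \<noteq> a" "p \<noteq> b" "p \<noteq> d" "p \<noteq> sup a b" "a \<noteq> sup a b" "b \<noteq> sup a b" "d \<noteq> sup a b"
    using assms(3-5) nle[of a b] nle[of b a] nle[of a d] assms less by (auto dest: coversD simp: le_iff_sup sup.commute)
  have univ: "UNIV = {M3_bot, M3_a, M3_b, M3_c, M3_top}"
    using M3.exhaust by blast
  have hom: "f (sup u v) = sup (f u) (f v) \<and> f (inf u v) = inf (f u) (f v)" for u v
    using less d sup assms(3-) inf[of a b] inf[of a d] inf[of b d] inf[of b a] inf[of d a] inf[of d b]
    by (cases u; cases v)
      (simp_all add: f_def sup_M3_def inf_M3_def less_eq_M3_def sup_absorb1 sup_absorb2
        inf_absorb1 inf_absorb2 le_supI1 sup.commute inf.commute)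
  have "inj f"
    using ne assms(6-) by (auto simp: inj_def f_def split: M3.splits)
  then have "lattice_iso_on f UNIV (range f)"
    using hom by (auto simp: lattice_iso_on_def bij_betw_def)
  moreover have "sublattice (range f)"
    using hom unfolding sublattice_def by (metis empty_not_UNIV image_is_empty rangeE rangeI)
  ultimately show False using assms(2) by (auto simp: slim_def)
qed

lemma ex_left_right:
  assumes "planar_lattice TYPE('a::{finite,lattice})"
    and sm: "semimodular TYPE('a)"
    and sl: "slim TYPE('a)"
  obtains l r :: "'a::{finite,lattice} \<Rightarrow> 'a" where "left_right l r"
proof -
  obtain pos :: "'a \<Rightarrow> real \<times> real" where "planar_hasse_diagram pos"
    using assms by (auto simp: planar_lattice_def)
  then interpret planar_diagram pos by unfold_locales
  interpret m: planar_diagram "\<lambda>v. (- fst (pos v), snd (pos v))"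
    by (rule planar_diagram_mirror) unfold_locales
  have slope_m: "m.slope p q = - slope p q" for p q
    by (simp add: m.slope_def slope_def minus_divide_left)
  have "\<exists>a. if \<exists>y. x < y then covers x a \<and> (\<forall>y. covers x y \<longrightarrow> slope x a \<le> slope x y) else a = x" for x
  proof (cases "\<exists>y. x < y")
    case True
    then obtain z where "covers x z" using ex_cover_below by blast
    then show ?thesis
      using True ex_is_arg_min_if_finite[of "Collect (covers x)" "slope x"]
      by (auto simp: is_arg_min_linorder)
  qed auto
  then obtain l where l: "\<And>x. if \<exists>y. x < y then covers x (l x) \<and> (\<forall>y. covers x y \<longrightarrow> slope x (l x) \<le> slope x y) else l x = x"
    by metis
  have "\<exists>a. if \<exists>y. x < y then covers x a \<and> (\<forall>y. covers x y \<longrightarrow> slope x y \<le> slope x a) else a = x" for x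
  proof (cases "\<exists>y. x < y")
    case True
    then obtain z where "covers x z" using ex_cover_below by blast
    then show ?thesis
      using True ex_is_arg_min_if_finite[of "Collect (covers x)" "\<lambda>y. - slope x y"]
      by (auto simp: is_arg_min_linorder)
  qed auto
  then obtain r where r: "\<And>x. if \<exists>y. x < y then covers x (r x) \<and> (\<forall>y. covers x y \<longrightarrow> slope x y \<le> slope x (r x)) else r x = x"
    by metis
  have quad: "covers a (sup a b)" "covers b (sup a b)" if "covers x a" "covers x b" "a \<noteq> b" for x a b :: 'a
    using covers_sup[OF sm that] covers_sup[OF sm that(2,1)] that(3) by (auto simp: sup.commute)
  \<comment> \<open>A third cover would lie strictly between the two in slope. Planarity then forces
    it below \<open>sup (l x) (r x)\<close>, which slimness forbids.\<close>
  have two: "y = l x \<or> y = r x" if "covers x y" for x y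
  proof (rule ccontr)
    assume n: "\<not> (y = l x \<or> y = r x)"
    have lr: "covers x (l x)" "covers x (r x)" "slope x (l x) \<le> slope x y" "slope x y \<le> slope x (r x)"
      using l[of x] r[of x] that coversD by (smt (verit, best))+
    then have ineq: "slope x (l x) < slope x y" "slope x y < slope x (r x)"
      using n that slope_inj by (metis order.order_iff_strict)+
    then have ne: "l x \<noteq> r x" by auto
    show False
      using no_cover_between[OF lr(1,2) quad[OF lr(1,2) ne] that _ ineq]
        slim_join_of_covers[OF sm sl lr(1,2) that] ne n by blast
  qed
  have rl: "r (l x) = sup (l x) (r x) \<and> l (r x) = sup (l x) (r x)" if "l x \<noteq> r x" for x
  proof -
    have "\<exists>y. x < y" using that l[of x] r[of x] by (auto split: if_splits)
    then have lr: "covers x (l x)" "covers x (r x)" "slope x (l x) \<le> slope x (r x)"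
      using l[of x] r[of x] by auto
    then have ineq: "slope x (l x) < slope x (r x)"
      using slope_inj[of x] that by (metis order.order_iff_strict)
    let ?c = "sup (l x) (r x)"
    note q = quad[OF lr(1,2) that]
    have "slope (l x) d \<le> slope (l x) ?c" if "covers (l x) d" for d
    proof (cases "d \<le> ?c")
      case True
      then show ?thesis using covers_incomparable[OF that q(1)] by simp
    next
      case False
      then show ?thesis using upper_cover_leftmost[OF lr(1,2) q ineq that] by simp
    qed
    then have "r (l x) = ?c"
      using r[of "l x"] q(1) slope_inj[OF _ q(1)] coversD[OF q(1)] by (metis order.antisym)
    \<comment> \<open>The same argument in the mirrored diagram, where slopes change sign.\<close>
    moreover have "slope (r x) d \<ge> slope (r x) ?c" if "covers (r x) d" for d
    proof (cases "d \<le> ?c")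
      case True
      then show ?thesis using covers_incomparable[OF that q(2)] by simp
    next
      case False
      then show ?thesis using m.upper_cover_leftmost[OF lr(2,1) q(2,1) _ that] ineq
        by (simp add: slope_m)
    qed
    then have "l (r x) = ?c"
      using l[of "r x"] q(2) slope_inj[OF _ q(2)] coversD[OF q(2)] by (metis order.antisym)
    ultimately show ?thesis by simp
  qed
  have "left_right l r"
  proof
    show "x < y \<Longrightarrow> covers x (l x)" "x < y \<Longrightarrow> covers x (r x)" for x y
      using l[of x] r[of x] by (auto split: if_splits)
    show "\<not> (\<exists>y. x < y) \<Longrightarrow> l x = x" "\<not> (\<exists>y. x < y) \<Longrightarrow> r x = x" for x
      using l[of x] r[of x] by (auto split: if_splits)
  qed (use two rl sm in auto)
  then show ?thesis using that by blast
qed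

section \<open>Grid coordinates\<close>

text \<open>The least element strictly above \<open>m\<close> is its unique upper cover; the top of
  a lattice is thereby excluded.\<close>

definition meet_irr :: "'a::order set" where
  "meet_irr = {m. \<exists>s>m. \<forall>g>m. s \<le> g}"

text \<open>\<open>Inf_fin UNIV\<close> is the bottom, so for \<open>l\<close> and \<open>r\<close>
  this is a maximal chain.\<close>

definition orbit :: "('a::{finite,lattice} \<Rightarrow> 'a) \<Rightarrow> 'a set" where
  "orbit f = range (\<lambda>k. (f ^^ k) (Inf_fin UNIV))"

definition rank :: "'a::order set \<Rightarrow> 'a \<Rightarrow> nat" where
  "rank C x = card (C \<inter> {..x})"

text \<open>Initial segments of a chain are nested, so their sizes compare as they do by
  inclusion.\<close>

lemma rank_le_iff:
  fixes C :: "'a::{finite,order} set"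
  assumes "\<forall>c\<in>C. \<forall>d\<in>C. c \<le> d \<or> d \<le> c"
  shows "rank C x \<le> rank C y \<longleftrightarrow> (\<forall>c\<in>C. c \<le> x \<longrightarrow> c \<le> y)"
proof
  assume le: "rank C x \<le> rank C y"
  have "C \<inter> {..x} \<subseteq> C \<inter> {..y} \<or> C \<inter> {..y} \<subseteq> C \<inter> {..x}"
    using assms by (auto intro: order.trans)
  then have "C \<inter> {..x} \<subseteq> C \<inter> {..y}"
    using le card_seteq[of "C \<inter> {..x}" "C \<inter> {..y}"] by (auto simp: rank_def)
  then show "\<forall>c\<in>C. c \<le> x \<longrightarrow> c \<le> y" by auto
qed (auto simp: rank_def intro!: card_mono)

lemma rank_inf:
  fixes C :: "'a::{finite,lattice} set"
  assumes "\<forall>c\<in>C. \<forall>d\<in>C. c \<le> d \<or> d \<le> c"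
  shows "rank C (inf x y) = min (rank C x) (rank C y)"
proof (cases "rank C x \<le> rank C y")
  case True
  then have "C \<inter> {..inf x y} = C \<inter> {..x}" using rank_le_iff[OF assms] by auto
  then show ?thesis using True by (simp add: rank_def)
next
  case False
  then have "C \<inter> {..inf x y} = C \<inter> {..y}" using rank_le_iff[OF assms, of y x] by auto
  then show ?thesis using False by (simp add: rank_def)
qed

lemma ex_meet_irr:
  fixes x c :: "'a::{finite,lattice}"
  assumes "\<not> c \<le> x"
  obtains m where "m \<in> meet_irr" "x \<le> m" "\<not> c \<le> m" "\<And>g. m < g \<Longrightarrow> c \<le> g"
proof -
  obtain m where m: "m \<in> {m. x \<le> m \<and> \<not> c \<le> m}" "\<forall>g\<in>{m. x \<le> m \<and> \<not> c \<le> m}. m \<le> g \<longrightarrow> m = g"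
    using finite_has_maximal[of "{m. x \<le> m \<and> \<not> c \<le> m}"] assms by auto
  then have *: "c \<le> g" if "m < g" for g
    using that by (metis (mono_tags, lifting) mem_Collect_eq less_imp_le order.trans less_irrefl)
  have "sup m c \<le> g" if "m < g" for g using * that by auto
  moreover have "m < sup m c" using m by (auto simp: less_le_not_le)
  ultimately have "m \<in> meet_irr" by (auto simp: meet_irr_def)
  with m * that show ?thesis by blast
qed

text \<open>Apply \<open>ex_meet_irr\<close> to the least chain element \<open>c\<close> not below
  \<open>x\<close>: avoiding \<open>c\<close>, \<open>m\<close> gains no chain element.\<close>

lemma meet_irr_same_rank:
  fixes C :: "'a::{finite,lattice} set"
  assumes "\<forall>c\<in>C. \<forall>d\<in>C. c \<le> d \<or> d \<le> c" and "rank C x < rank C y"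
  shows "\<exists>m\<in>meet_irr. x \<le> m \<and> rank C m = rank C x"
proof -
  have "{c\<in>C. \<not> c \<le> x} \<noteq> {}" using assms rank_le_iff[OF assms(1), of y x] by auto
  then obtain c where c: "c \<in> C" "\<not> c \<le> x" "\<forall>d\<in>{c\<in>C. \<not> c \<le> x}. d \<le> c \<longrightarrow> c = d"
    using finite_has_minimal[of "{c\<in>C. \<not> c \<le> x}"] by auto
  then have least: "c \<le> d" if "d \<in> C" "\<not> d \<le> x" for d
    using that assms(1) c by (metis (mono_tags, lifting) mem_Collect_eq order_refl)
  obtain m where m: "m \<in> meet_irr" "x \<le> m" "\<not> c \<le> m" using ex_meet_irr c by metis
  then have "C \<inter> {..m} = C \<inter> {..x}" using least by auto (meson order.trans)
  with m show ?thesis by (auto simp: rank_def)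
qed

text \<open>All that the study of congruences needs. Meets are coordinatewise, while no such rule is
  assumed for joins.\<close>

locale grid =
  fixes i j :: "'a::{finite,lattice} \<Rightarrow> nat"
  assumes le_iff: "x \<le> y \<longleftrightarrow> i x \<le> i y \<and> j x \<le> j y"
    and i_inf: "i (inf x y) = min (i x) (i y)"
    and j_inf: "j (inf x y) = min (j x) (j y)"
    and i_inj: "m \<in> meet_irr \<Longrightarrow> m' \<in> meet_irr \<Longrightarrow> i m = i m' \<Longrightarrow> m = m'"
    and j_inj: "m \<in> meet_irr \<Longrightarrow> m' \<in> meet_irr \<Longrightarrow> j m = j m' \<Longrightarrow> m = m'"
    and i_meet_irr: "i x < i y \<Longrightarrow> \<exists>m\<in>meet_irr. x \<le> m \<and> i m = i x"
    and j_meet_irr: "j x < j y \<Longrightarrow> \<exists>m\<in>meet_irr. x \<le> m \<and> j m = j x"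

section \<open>The two boundary chains generate the lattice\<close>

context left_right
begin

lemma mirror: "left_right r l"
  using covers_l covers_r covers_cases r_l l_r top_l top_r semimod
  by unfold_locales (metis sup.commute)+

lemma le_l: "x \<le> l x"
  using covers_l[of x] top_l[of x] coversD by (metis order.strict_implies_order order_refl)

lemma orbit_total: "\<forall>c\<in>orbit l. \<forall>d\<in>orbit l. c \<le> d \<or> d \<le> c"
proof -
  have "(l ^^ m) x \<le> (l ^^ n) x" if "m \<le> n" for m n x
    using that by (induction rule: dec_induct) (auto intro: le_l order.trans)
  then show ?thesis by (auto simp: orbit_def) (meson nle_le)
qed

text \<open>\<open>q\<close> is the last chain element below \<open>x\<close>; it exists because the
  chain starts at the bottom.\<close>

lemma orbit_step:
  assumes "c \<in> orbit l" "\<not> c \<le> x"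
  obtains q where "q \<in> orbit l" "l q \<in> orbit l" "q \<le> x" "\<not> l q \<le> x"
    "\<And>d. d \<in> orbit l \<Longrightarrow> d \<le> x \<Longrightarrow> d \<le> q"
proof -
  define b where "b = (Inf_fin UNIV :: 'a)"
  obtain n where n: "\<not> (l ^^ n) b \<le> x" using assms by (auto simp: orbit_def b_def)
  define k where "k = (LEAST k. \<not> (l ^^ k) b \<le> x)"
  have k: "\<not> (l ^^ k) b \<le> x" unfolding k_def using n by (rule LeastI)
  have lt: "(l ^^ m) b \<le> x" if "m < k" for m using that not_less_Least k_def by blast
  have "b \<le> x" unfolding b_def by (rule Inf_fin.coboundedI) auto
  with k obtain k' where k': "k = Suc k'" by (cases k) auto
  have mono: "(l ^^ m) y \<le> (l ^^ n) y" if "m \<le> n" for m n y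
    using that by (induction rule: dec_induct) (auto intro: le_l order.trans)
  show ?thesis
  proof (rule that[of "(l ^^ k') b"])
    show "(l ^^ k') b \<in> orbit l" by (auto simp: orbit_def b_def)
    have "l ((l ^^ k') b) = (l ^^ Suc k') b" by simp
    then show "l ((l ^^ k') b) \<in> orbit l" unfolding orbit_def b_def by blast
    show "(l ^^ k') b \<le> x" "\<not> l ((l ^^ k') b) \<le> x" using lt k k' by auto
    fix d assume "d \<in> orbit l" "d \<le> x"
    then obtain m where m: "d = (l ^^ m) b" by (auto simp: orbit_def b_def)
    have "m < k" using \<open>d \<le> x\<close> k mono[of k m b] m by (meson leI order.trans)
    then show "d \<le> (l ^^ k') b" using mono[of m k' b] m k' by auto
  qed
qed

lemma orbit_cofinal:
  assumes "x < y"
  shows "\<exists>c\<in>orbit l. \<not> c \<le> x"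
proof (rule ccontr)
  assume n: "\<not> ?thesis"
  have ne: "orbit l \<noteq> {}" by (auto simp: orbit_def)
  obtain c where c: "c \<in> orbit l" "\<forall>d\<in>orbit l. c \<le> d \<longrightarrow> c = d"
    using finite_has_maximal[OF _ ne] by auto
  from c(1) obtain k where "c = (l ^^ k) (Inf_fin UNIV)" by (auto simp: orbit_def)
  then have "l c = (l ^^ Suc k) (Inf_fin UNIV)" by simp
  then have "l c \<in> orbit l" unfolding orbit_def by blast
  then have "c = l c" using c le_l by blast
  moreover have "c < y" using n c assms by force
  ultimately show False using covers_l[of c y] coversD by fastforce
qed

text \<open>Going up from \<open>q\<close> to \<open>x\<close>, each step must use the right cover,
  since the left one is not below \<open>x\<close>; \<open>l_r\<close> carries the join with
  \<open>l q\<close> along.\<close>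

lemma l_eq_sup:
  assumes "q \<le> x" "\<not> l q \<le> x"
  shows "l x = sup x (l q)"
  using assms
proof (induction q rule: finite_greater_induct)
  case (greater q)
  show ?case
  proof (cases "q = x")
    case True
    then show ?thesis using le_l[of x] by (simp add: sup_absorb2)
  next
    case False
    then obtain q1 where q1: "covers q q1" "q1 \<le> x"
      using greater.prems ex_cover_below[of q x] by (metis order.order_iff_strict)
    then have "q1 \<noteq> l q" using greater.prems by auto
    then have "q1 = r q" "l q \<noteq> r q" using covers_cases[OF q1(1)] by auto
    then have l: "l q1 = sup q1 (l q)" using l_r by (simp add: sup.commute)
    then have "l x = sup x (l q1)"
      using greater.IH[of q1] q1 greater.prems coversD by (metis le_supE)
    then show ?thesis using l q1 by (metis sup.absorb1 sup_assoc)
  qed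
qed

text \<open>With at most two covers per element, \<open>x\<close> and \<open>y\<close>, unless equal
  to \<open>p\<close>, both lie above the other cover of \<open>p\<close>, and the claim moves up
  the cell to that cover.\<close>

lemma kappa:
  assumes "covers p (c::'a)" "p \<le> x" "p \<le> y" "\<not> c \<le> x" "\<not> c \<le> y"
  shows "\<not> c \<le> sup x y"
  using assms
proof (induction p arbitrary: c rule: finite_greater_induct)
  case (greater p)
  show ?case
  proof (cases "p = x \<or> p = y")
    case True
    then show ?thesis using greater.prems by (auto simp: sup_absorb1 sup_absorb2)
  next
    case False
    then obtain x1 y1 where xy: "covers p x1" "x1 \<le> x" "covers p y1" "y1 \<le> y"
      using greater.prems ex_cover_below[of p x] ex_cover_below[of p y]
      by (metis order.order_iff_strict)
    then have ne: "x1 \<noteq> c" "y1 \<noteq> c" using greater.prems by auto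
    then have "x1 = y1"
      using covers_cases[OF xy(1)] covers_cases[OF xy(3)] covers_cases[OF greater.prems(1)] by auto
    then have "\<not> sup x1 c \<le> sup x y"
      using greater.IH[of x1 "sup x1 c"] covers_sup[OF semimod xy(1) greater.prems(1) ne(1)]
        coversD[OF xy(1)] xy greater.prems by auto
    then show ?thesis using xy(2) by (auto intro: le_supI1)
  qed
qed

lemma meet_irr_above:
  assumes "m \<in> meet_irr" "covers q (c::'a)" "q \<le> m" "\<not> c \<le> m" "m < g"
  shows "c \<le> g"
proof -
  obtain s where s: "m < s" "\<And>g. m < g \<Longrightarrow> s \<le> g" using assms by (auto simp: meet_irr_def)
  have cov: "covers m (sup m c)" by (rule semimodularD[OF semimod assms(2-4)])
  then have "s = sup m c"
    using s covers_between[OF cov, of s] coversD[OF cov] by (auto simp: less_imp_le)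
  then show ?thesis using s(2)[OF assms(5)] by auto
qed

text \<open>Equal ranks mean the same last chain element \<open>q\<close>. By \<open>kappa\<close>
  the join of the two still avoids \<open>l q\<close>, whereas by \<open>meet_irr_above\<close>
  nothing strictly above either of them does.\<close>

lemma rank_inj:
  assumes "m \<in> meet_irr" "m' \<in> meet_irr" "rank (orbit l) m = rank (orbit l) m'"
  shows "m = m'"
proof (rule ccontr)
  assume ne: "m \<noteq> m'"
  obtain s where s: "m < s" using assms by (auto simp: meet_irr_def)
  obtain c where c: "c \<in> orbit l" "\<not> c \<le> m" using orbit_cofinal[OF s] by auto
  obtain q where q: "q \<in> orbit l" "l q \<in> orbit l" "q \<le> m" "\<not> l q \<le> m"
    using orbit_step[OF c] by blast
  then have cov: "covers q (l q)" using covers_l[of q s] s by auto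
  have "\<forall>c\<in>orbit l. c \<le> m \<longleftrightarrow> c \<le> m'"
    using rank_le_iff[OF orbit_total, of m m'] rank_le_iff[OF orbit_total, of m' m] assms(3) by auto
  then have q': "q \<le> m'" "\<not> l q \<le> m'" using q by auto
  have "\<not> l q \<le> sup m m'" using kappa[OF cov q(3) q'(1) q(4) q'(2)] .
  moreover have "m < sup m m' \<or> m' < sup m m'" using ne
    by (metis order.not_eq_order_implies_strict sup.cobounded1 sup.cobounded2)
  ultimately show False
    using meet_irr_above[OF assms(1) cov q(3,4)] meet_irr_above[OF assms(2) cov q'] by blast
qed

text \<open>With \<open>q\<close> the last chain element below \<open>x\<close>, the element
  \<open>l x\<close> is the join of \<open>x\<close> and \<open>l q\<close>, and \<open>l q\<close>
  absorbs \<open>c\<close>.\<close>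

lemma l_decomposition:
  assumes "x < l x" "c \<in> orbit l" "x = sup c d"
  shows "\<exists>c'\<in>orbit l. l x = sup c' d"
proof -
  obtain c1 where c1: "c1 \<in> orbit l" "\<not> c1 \<le> x" using orbit_cofinal[OF assms(1)] by auto
  obtain q where q: "l q \<in> orbit l" "q \<le> x" "\<not> l q \<le> x" "c \<le> q"
    using orbit_step[OF c1] assms by (metis sup.cobounded1)
  have "l x = sup x (l q)" by (rule l_eq_sup[OF q(2,3)])
  also have "\<dots> = sup (l q) d"
    using q(4) le_l[of q] assms(3)
    by (metis order.trans sup.absorb2 sup.commute sup.left_commute)
  finally show ?thesis using q by blast
qed

end

context left_right
begin

interpretation m: left_right r l by (rule mirror)

lemma decomposition: "\<exists>c\<in>orbit l. \<exists>d\<in>orbit r. x = sup c d"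
proof (induction x rule: finite_less_induct)
  case (less y)
  show ?case
  proof (cases "y = Inf_fin UNIV")
    case True
    have "Inf_fin UNIV \<in> orbit f" for f :: "'a \<Rightarrow> 'a"
      unfolding orbit_def by (rule range_eqI[of _ _ 0]) simp
    with True show ?thesis by (metis sup.idem)
  next
    case False
    have "Inf_fin UNIV \<le> y" by (rule Inf_fin.coboundedI) auto
    with False obtain x where x: "covers x y" by (metis ex_cover_above order.order_iff_strict)
    then obtain c d where cd: "c \<in> orbit l" "d \<in> orbit r" "x = sup c d"
      using less.IH coversD by blast
    from covers_cases[OF x] show ?thesis
    proof
      assume "y = l x"
      then show ?thesis using l_decomposition[of x c d] cd x coversD by metis
    next
      assume "y = r x"
      then show ?thesis using m.l_decomposition[of x d c] cd x coversD by (metis sup.commute)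
    qed
  qed
qed

lemma grid: "grid (rank (orbit l)) (rank (orbit r))"
proof
  fix x y :: 'a
  obtain c d where "c \<in> orbit l" "d \<in> orbit r" "x = sup c d" using decomposition by blast
  then show "x \<le> y \<longleftrightarrow> rank (orbit l) x \<le> rank (orbit l) y \<and> rank (orbit r) x \<le> rank (orbit r) y"
    using rank_le_iff[OF orbit_total] rank_le_iff[OF m.orbit_total] by (auto intro: order.trans)
qed (auto intro: rank_inj m.rank_inj intro!: rank_inf orbit_total m.orbit_total
    meet_irr_same_rank[OF orbit_total] meet_irr_same_rank[OF m.orbit_total])

end

section \<open>Congruences and closed sets of meet-irreducibles\<close>

definition collapsed :: "('a::lattice \<times> 'a) set \<Rightarrow> 'a set" where
  "collapsed \<theta> = {m \<in> meet_irr. \<exists>s>m. (m, s) \<in> \<theta>}"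

text \<open>An element of a finite lattice is determined by the meet-irreducibles above it; this
  relation forgets those in \<open>S\<close>. It is a congruence only for suitable
  \<open>S\<close>.\<close>

definition collapse :: "'a::lattice set \<Rightarrow> ('a \<times> 'a) set" where
  "collapse S = {(x, y). \<forall>m\<in>meet_irr - S. x \<le> m \<longleftrightarrow> y \<le> m}"

lemma JD:
  assumes "x \<in> J D"
  shows "x \<in> D" "\<not> is_zero_in D x" "a \<in> D \<Longrightarrow> b \<in> D \<Longrightarrow> is_join_in D a b x \<Longrightarrow> x = a \<or> x = b"
  using assms unfolding J_def by blast+

lemma congruenceD:
  assumes "lattice_congruence \<theta>"
  shows "(x, x) \<in> \<theta>" "(x, y) \<in> \<theta> \<Longrightarrow> (y, x) \<in> \<theta>" "(x, y) \<in> \<theta> \<Longrightarrow> (y, z) \<in> \<theta> \<Longrightarrow> (x, z) \<in> \<theta>"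
    "(x, y) \<in> \<theta> \<Longrightarrow> (sup x z, sup y z) \<in> \<theta>" "(x, y) \<in> \<theta> \<Longrightarrow> (inf x z, inf y z) \<in> \<theta>"
  using assms by (auto simp: lattice_congruence_def equiv_def refl_on_def dest: symD transD)

lemma congruenceI:
  fixes \<theta> :: "('a::lattice \<times> 'a) set"
  assumes "equiv UNIV \<theta>" "\<And>x y z. (x, y) \<in> \<theta> \<Longrightarrow> (sup x z, sup y z) \<in> \<theta>"
    "\<And>x y z. (x, y) \<in> \<theta> \<Longrightarrow> (inf x z, inf y z) \<in> \<theta>"
  shows "lattice_congruence \<theta>"
proof -
  have "trans \<theta>" using assms by (auto simp: equiv_def)
  then show ?thesis
    unfolding lattice_congruence_def using assms
    by (metis inf.commute sup.commute transD)
qed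

lemma collapsed_collapse:
  assumes "S \<subseteq> meet_irr"
  shows "collapsed (collapse S) = S"
proof (intro set_eqI iffI)
  fix m assume m: "m \<in> S"
  then obtain s where s: "m < s" "\<forall>g>m. s \<le> g" using assms by (auto simp: meet_irr_def)
  have "(m, s) \<in> collapse S"
    using s m by (auto simp: collapse_def) (metis order.not_eq_order_implies_strict)
  then show "m \<in> collapsed (collapse S)" using s m assms by (auto simp: collapsed_def)
qed (auto simp: collapsed_def collapse_def dest: leD)

lemma collapsed_mono: "\<theta> \<subseteq> \<eta> \<Longrightarrow> collapsed \<theta> \<subseteq> collapsed \<eta>"
  by (auto simp: collapsed_def)

lemma collapse_mono: "S \<subseteq> T \<Longrightarrow> collapse S \<subseteq> collapse T"
  by (auto simp: collapse_def)

lemma collapse_collapsed: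
  fixes \<theta> :: "('a::{finite,lattice} \<times> 'a) set"
  assumes "lattice_congruence \<theta>"
  shows "collapse (collapsed \<theta>) = \<theta>"
proof (intro equalityI subrelI)
  note con = congruenceD[OF assms]
  fix x y assume xy: "(x, y) \<in> \<theta>"
  \<comment> \<open>A meet-irreducible separating a congruent pair is collapsed: join the pair with
    it.\<close>
  have "m \<in> collapsed \<theta>" if "(u, v) \<in> \<theta>" "m \<in> meet_irr" "u \<le> m" "\<not> v \<le> m" for m u v
  proof -
    have "(m, sup v m) \<in> \<theta>" using con(4)[OF that(1), of m] that(3) by (simp add: sup_absorb2)
    moreover have "m < sup v m" using that(4) by (simp add: less_le_not_le)
    ultimately show ?thesis using that by (auto simp: collapsed_def)
  qed
  from this[OF xy] this[OF con(2)[OF xy]] show "(x, y) \<in> collapse (collapsed \<theta>)"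
    by (auto simp: collapse_def)
next
  note con = congruenceD[OF assms]
  \<comment> \<open>Climb from \<open>x\<close> to \<open>y\<close> by covers. Each covering pair
    arises from a collapsed pair \<open>(m, s)\<close> by meeting it with the upper element
    \<open>x'\<close>.\<close>
  have *: "(x, y) \<in> \<theta>" if "x \<le> y" "(x, y) \<in> collapse (collapsed \<theta>)" for x y
    using that
  proof (induction x rule: finite_greater_induct)
    case (greater x)
    show ?case
    proof (cases "x = y")
      case False
      then obtain x' where x': "covers x x'" "x' \<le> y"
        using greater.prems ex_cover_below by (metis order.order_iff_strict)
      have "\<not> x' \<le> x" using coversD[OF x'(1)] by auto
      then obtain m where m: "m \<in> meet_irr" "x \<le> m" "\<not> x' \<le> m" "\<And>g. m < g \<Longrightarrow> x' \<le> g"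
        using ex_meet_irr by metis
      then have "m \<in> collapsed \<theta>"
        using greater.prems(2) x'(2) by (auto simp: collapse_def dest: order.trans[OF x'(2)])
      then obtain s where s: "m < s" "(m, s) \<in> \<theta>" by (auto simp: collapsed_def)
      have "inf m x' = x"
        using covers_between[OF x'(1), of "inf m x'"] m coversD[OF x'(1)]
        by (metis inf.cobounded1 inf.cobounded2 le_inf_iff less_imp_le)
      moreover have "inf s x' = x'" using m(4)[OF s(1)] by (simp add: inf_absorb2)
      ultimately have 1: "(x, x') \<in> \<theta>" using con(5)[OF s(2), of x'] by simp
      have "(x', y) \<in> collapse (collapsed \<theta>)"
        using greater.prems(2) order.trans[OF x'(2)]
          order.trans[OF less_imp_le[OF coversD[OF x'(1)]]]
        unfolding collapse_def by blast
      then have "(x', y) \<in> \<theta>" using greater.IH coversD x' by blast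
      then show ?thesis using 1 con(3) by blast
    qed (use con(1) in simp)
  qed
  fix x y assume xy: "(x, y) \<in> collapse (collapsed \<theta>)"
  then have "(x, sup x y) \<in> collapse (collapsed \<theta>)" "(y, sup x y) \<in> collapse (collapsed \<theta>)"
    by (auto simp: collapse_def)
  then have "(x, sup x y) \<in> \<theta>" "(y, sup x y) \<in> \<theta>" using * by auto
  then show "(x, y) \<in> \<theta>" using con(3)[OF _ con(2)] by blast
qed

section \<open>Closure under \<open>under\<close> characterizes congruences\<close>

context grid
begin

lemma mirror: "grid j i"
  using le_iff i_inf j_inf i_inj j_inj i_meet_irr j_meet_irr by unfold_locales auto

text \<open>
  The diagram is read with \<open>i\<close> as the horizontal and \<open>j\<close> as the vertical coordinate: \<open>nw a b\<close> means
  that \<open>a\<close> is north-west of \<open>b\<close>, and exchanging \<open>i\<close> and \<open>j\<close> mirrors the picture.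
\<close>

definition nw :: "'a \<Rightarrow> 'a \<Rightarrow> bool" where
  "nw a b \<longleftrightarrow> i a < i b \<and> j b < j a"

definition up :: "'a \<Rightarrow> 'a set" where
  "up e = {f \<in> meet_irr. e < f}"

definition internal :: "'a \<Rightarrow> bool" where
  "internal e \<longleftrightarrow> e \<in> meet_irr \<and> (\<exists>a\<in>meet_irr. nw a e) \<and> (\<exists>a\<in>meet_irr. nw e a)"

definition under :: "'a \<Rightarrow> 'a \<Rightarrow> bool" where
  "under e m \<longleftrightarrow> internal e \<and> m \<in> meet_irr \<and> (nw m e \<or> nw e m) \<and> up m \<subseteq> up e"

definition below :: "'a \<Rightarrow> 'a \<Rightarrow> bool" where
  "below = under\<^sup>*\<^sup>*"

definition closed_down :: "'a set \<Rightarrow> bool" where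
  "closed_down S \<longleftrightarrow> S \<subseteq> meet_irr \<and> (\<forall>e m. under e m \<and> m \<in> S \<longrightarrow> e \<in> S)"

end

text \<open>Exchanging the coordinates only flips \<open>nw\<close>, so each lemma about one side of
  an element transfers to the other through the interpretation \<open>m\<close>.\<close>

lemma (in grid) mirror_simps:
  "grid.nw j i a b \<longleftrightarrow> nw b a" "grid.internal j i e \<longleftrightarrow> internal e"
  "grid.under j i e m \<longleftrightarrow> under e m" "grid.below j i e m \<longleftrightarrow> below e m"
  "grid.closed_down j i S \<longleftrightarrow> closed_down S"
proof -
  interpret m: grid j i by (rule mirror)
  show 1: "m.nw a b \<longleftrightarrow> nw b a" for a b
    by (auto simp: m.nw_def nw_def)
  show 2: "m.internal e \<longleftrightarrow> internal e" for e
    by (auto simp: m.internal_def internal_def 1)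
  show 4: "m.under e m \<longleftrightarrow> under e m" for e m
    by (auto simp: m.under_def under_def 1 2)
  then have "m.under = under" by blast
  then show "m.below e m \<longleftrightarrow> below e m" "m.closed_down S \<longleftrightarrow> closed_down S"
    by (auto simp: m.below_def below_def m.closed_down_def closed_down_def)
qed

context grid
begin

lemma lessD: "a < b \<Longrightarrow> i a \<le> i b \<and> j a \<le> j b"
  using le_iff[of a b] by auto

lemma meet_irr_cases:
  assumes "a \<in> meet_irr" "b \<in> meet_irr"
  shows "a = b \<or> a < b \<or> b < a \<or> nw a b \<or> nw b a"
  using i_inj[OF assms] j_inj[OF assms] le_iff[of a b] le_iff[of b a]
  by (auto simp: nw_def less_le_not_le)

lemma meet_irr_less_iff:
  assumes "a \<in> meet_irr" "b \<in> meet_irr"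
  shows "a < b \<longleftrightarrow> i a < i b \<and> j a < j b"
  using i_inj[OF assms] j_inj[OF assms] le_iff[of a b] le_iff[of b a]
  by (cases "a = b") (auto simp: less_le_not_le)

text \<open>Meet the collapsed pair \<open>(m, s)\<close> with some \<open>c\<close> south-east of
  \<open>e\<close>: \<open>inf m c\<close> is below \<open>e\<close>, \<open>inf s c\<close> is not.
  Joining with \<open>e\<close> then collapses \<open>e\<close>.\<close>

lemma closed_step:
  assumes "lattice_congruence \<theta>" "under e m" "nw m e" "m \<in> collapsed \<theta>"
  shows "e \<in> collapsed \<theta>"
proof -
  note con = congruenceD[OF assms(1)]
  obtain s where s: "m < s" "(m, s) \<in> \<theta>" using assms(4) by (auto simp: collapsed_def)
  obtain c where c: "nw e c" and e: "e \<in> meet_irr"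
    using assms(2) by (auto simp: under_def internal_def)
  have le: "inf m c \<le> e"
    using c assms(3) by (auto simp: le_iff i_inf j_inf nw_def)
  have "\<not> inf s c \<le> e"
  proof
    assume "inf s c \<le> e"
    then have is_e: "i s \<le> i e" using c by (auto simp: le_iff i_inf nw_def min_def split: if_splits)
    then have "i s < i c" using c by (auto simp: nw_def)
    then obtain f where f: "f \<in> meet_irr" "s \<le> f" "i f = i s" using i_meet_irr by blast
    then have "f \<in> up e" using s assms(2) by (auto simp: up_def under_def)
    then show False using is_e f e meet_irr_less_iff[of e f] by (auto simp: up_def)
  qed
  then have "e < sup (inf s c) e" by (simp add: less_le_not_le)
  moreover have "(e, sup (inf s c) e) \<in> \<theta>"
    using con(4)[OF con(5)[OF s(2), of c], of e] le by (simp add: sup_absorb2)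
  ultimately show ?thesis using e by (auto simp: collapsed_def)
qed

text \<open>A meet-irreducible strictly above \<open>m\<close> has larger \<open>j\<close> than
  \<open>e\<close>, so unless it is above \<open>e\<close> it is again north-west of
  \<open>e\<close>, against maximality.\<close>

lemma under_maximal_nw:
  assumes "internal e" "m \<in> meet_irr" "nw m e" "\<And>a. a \<in> meet_irr \<Longrightarrow> nw a e \<Longrightarrow> \<not> m < a"
  shows "under e m"
proof -
  have "f \<in> up e" if "f \<in> up m" for f
    using that assms meet_irr_cases[of f e] lessD[of m f] lessD[of f e]
    by (auto simp: up_def internal_def nw_def)
  then show ?thesis using assms by (auto simp: under_def)
qed

lemma ex_under_nw:
  assumes "internal e" "a \<in> meet_irr" "nw a e"
  obtains m where "under e m" "nw m e" "a \<le> m" "m \<in> meet_irr"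
proof -
  let ?A = "{m \<in> meet_irr. nw m e \<and> a \<le> m}"
  obtain m where m: "m \<in> ?A" "\<forall>b\<in>?A. m \<le> b \<longrightarrow> m = b"
    using finite_has_maximal[of ?A] assms by auto
  have "under e m"
  proof (rule under_maximal_nw)
    fix b assume b: "b \<in> meet_irr" "nw b e"
    show "\<not> m < b" 
    proof
      assume "m < b"
      then have "b \<in> ?A" using m b by auto
      with m \<open>m < b\<close> show False by auto
    qed
  qed (use m assms in auto)
  then show ?thesis using that m by auto
qed

text \<open>Otherwise meet-irreducibles above \<open>x\<close> and \<open>z\<close> lie north-west
  and south-east of \<open>e\<close>, so \<open>e\<close> is internal. Some \<open>g\<close> above
  \<open>x\<close> but not above \<open>y\<close> satisfies \<open>under e g\<close>; it lies in
  \<open>S\<close>, and closure puts \<open>e\<close> there too.\<close>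

lemma collapse_inf_aux:
  assumes "closed_down S" "(x, y) \<in> collapse S" "e \<in> meet_irr" "inf x z \<le> e"
    and gt: "i e < i y" "i e < i z"
  shows "e \<in> S"
proof (rule ccontr)
  assume e: "e \<notin> S"
  have xy: "x \<le> m \<longleftrightarrow> y \<le> m" if "m \<in> meet_irr" "m \<notin> S" for m
    using assms(2) that by (auto simp: collapse_def)
  have "\<not> y \<le> e" using gt by (auto simp: le_iff)
  then have nx: "\<not> x \<le> e" using xy e assms(3) by blast
  have ix: "i x \<le> i e" using assms(4) gt by (auto simp: le_iff i_inf)
  then have jx: "j e < j x" using nx by (auto simp: le_iff)
  then have jz: "j z \<le> j e" using assms(4) by (auto simp: le_iff j_inf)
  obtain f where f: "f \<in> meet_irr" "x \<le> f" "i f = i x"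
    using i_meet_irr[of x y] ix gt by auto
  then have "j e < j f" using jx by (auto simp: le_iff)
  then have "nw f e" using f ix i_inj[OF f(1) assms(3)] by (auto simp: nw_def order.order_iff_strict)
  obtain f' where f': "f' \<in> meet_irr" "z \<le> f'" "j f' = j z"
    using j_meet_irr[of z x] jx jz by auto
  then have "i e < i f'" using gt by (auto simp: le_iff)
  then have "nw e f'" using f' jz j_inj[OF f'(1) assms(3)] by (auto simp: nw_def order.order_iff_strict)
  have int: "internal e" using \<open>nw f e\<close> \<open>nw e f'\<close> f f' assms(3) by (auto simp: internal_def)
  obtain g where g: "under e g" "nw g e" "f \<le> g" "g \<in> meet_irr"
    using ex_under_nw[OF int f(1) \<open>nw f e\<close>] by blast
  have "x \<le> g" using f g by auto
  moreover have "\<not> y \<le> g" using g gt by (auto simp: le_iff nw_def)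
  ultimately have "g \<in> S" using xy g(4) by blast
  then show False using assms(1) g(1) e by (auto simp: closed_down_def)
qed

end

context grid
begin

interpretation m: grid j i by (rule mirror)

lemma closed_collapsed:
  assumes "lattice_congruence \<theta>"
  shows "closed_down (collapsed \<theta>)"
proof -
  have "e \<in> collapsed \<theta>" if "under e m" "m \<in> collapsed \<theta>" for e m
    using that closed_step[OF assms, of e m] m.closed_step[OF assms, of e m]
    by (auto simp: under_def mirror_simps)
  then show ?thesis by (auto simp: closed_down_def) (auto simp: collapsed_def)
qed

lemma congruence_collapse:
  assumes "closed_down S"
  shows "lattice_congruence (collapse S)"
proof (rule congruenceI)
  show "equiv UNIV (collapse S)"
    by (rule equivI) (auto simp: collapse_def refl_on_def sym_def trans_def)
  fix x y z
  assume xy: "(x, y) \<in> collapse S"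
  then show "(sup x z, sup y z) \<in> collapse S" by (auto simp: collapse_def)
  have *: "inf v z \<le> e" if "(u, v) \<in> collapse S" "e \<in> meet_irr" "e \<notin> S" "inf u z \<le> e" for u v e
  proof (rule ccontr)
    assume "\<not> inf v z \<le> e"
    then have "i e < i v \<and> i e < i z \<or> j e < j v \<and> j e < j z"
      by (simp add: le_iff i_inf j_inf not_le)
    then show False
      using collapse_inf_aux[OF assms that(1,2,4)] m.collapse_inf_aux[of S u v e z] that assms
      by (auto simp: mirror_simps)
  qed
  have yx: "(y, x) \<in> collapse S" using xy by (auto simp: collapse_def)
  have "inf x z \<le> e \<longleftrightarrow> inf y z \<le> e" if "e \<in> meet_irr - S" for e
    using *[OF xy, of e] *[OF yx, of e] that by blast
  then show "(inf x z, inf y z) \<in> collapse S" by (simp add: collapse_def)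
qed

section \<open>Join-irreducible congruences\<close>

lemma below_meet_irr: "below e m \<Longrightarrow> m \<in> meet_irr \<Longrightarrow> e \<in> meet_irr"
  unfolding below_def by (induction rule: converse_rtranclp_induct) (auto simp: under_def internal_def)

lemma below_trans: "below a b \<Longrightarrow> below b c \<Longrightarrow> below a c"
  by (auto simp: below_def)

lemma below_refl [simp]: "below a a"
  by (auto simp: below_def)

lemma under_below: "under a b \<Longrightarrow> below a b"
  by (auto simp: below_def)

text \<open>For meet-irreducible \<open>e\<close>, the least congruence collapsing \<open>e\<close>;
  see \<open>cg_le_congruence\<close>.\<close>

definition cg :: "'a \<Rightarrow> ('a \<times> 'a) set" where
  "cg e = collapse {f. below f e}"

lemma closed_down_below: "e \<in> meet_irr \<Longrightarrow> closed_down {f. below f e}"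
  by (auto simp: closed_down_def intro: below_meet_irr below_trans[OF under_below])

lemma collapsed_cg: "e \<in> meet_irr \<Longrightarrow> collapsed (cg e) = {f. below f e}"
  using closed_down_below[of e] by (simp add: cg_def closed_down_def collapsed_collapse)

lemma cg_le_iff:
  assumes "e \<in> meet_irr" "f \<in> meet_irr"
  shows "cg e \<le> cg f \<longleftrightarrow> below e f"
proof
  assume "cg e \<le> cg f"
  then have "collapsed (cg e) \<subseteq> collapsed (cg f)" by (rule collapsed_mono)
  then show "below e f" using assms below_refl[of e] by (simp add: collapsed_cg subset_iff)
next
  assume "below e f"
  then have "{g. below g e} \<subseteq> {g. below g f}" using below_trans by auto
  then show "cg e \<le> cg f" unfolding cg_def by (rule collapse_mono)
qed

lemma cg_Con: "e \<in> meet_irr \<Longrightarrow> cg e \<in> Con TYPE('a)"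
  by (simp add: cg_def Con_def congruence_collapse closed_down_below)

lemma cg_le_congruence:
  assumes "lattice_congruence \<theta>" "e \<in> collapsed \<theta>"
  shows "cg e \<le> \<theta>"
proof -
  have closed: "closed_down (collapsed \<theta>)" by (rule closed_collapsed[OF assms(1)])
  have "f \<in> collapsed \<theta>" if "below f e" for f
    using that assms(2) closed unfolding below_def
    by (induction rule: converse_rtranclp_induct) (auto simp: closed_down_def)
  then have "cg e \<subseteq> collapse (collapsed \<theta>)" unfolding cg_def by (intro collapse_mono) auto
  then show ?thesis using collapse_collapsed[OF assms(1)] by simp
qed

lemma J_Con: "J (Con TYPE('a)) = cg ` meet_irr"
proof (intro equalityI subsetI)
  fix \<theta> assume J: "\<theta> \<in> J (Con TYPE('a))"
  have con: "lattice_congruence \<theta>" using JD(1)[OF J] by (simp add: Con_def)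
  define S where "S = collapsed \<theta>"
  have S: "closed_down S" "collapse S = \<theta>"
    using closed_collapsed collapse_collapsed con by (auto simp: S_def)
  have "S \<noteq> {}"
  proof
    assume "S = {}"
    have "\<theta> \<le> \<eta>" if "\<eta> \<in> Con TYPE('a)" for \<eta>
      using collapse_mono[of S "collapsed \<eta>"] collapse_collapsed[of \<eta>] that S \<open>S = {}\<close>
      by (auto simp: Con_def)
    then have "is_zero_in (Con TYPE('a)) \<theta>" using con by (simp add: is_zero_in_def Con_def)
    then show False using JD(2)[OF J] by contradiction
  qed
  \<comment> \<open>\<open>below\<close> may have cycles, so \<open>e\<close> is maximal only up to
    equivalence; it comes from an inclusion-maximal down-set.\<close>
  then obtain e where e: "e \<in> S" "\<And>f. f \<in> S \<Longrightarrow> below e f \<Longrightarrow> below f e"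
  proof -
    obtain D where D: "D \<in> (\<lambda>e. {f. below f e}) ` S" "\<forall>E\<in>(\<lambda>e. {f. below f e}) ` S. D \<subseteq> E \<longrightarrow> D = E"
      using finite_has_maximal[of "(\<lambda>e. {f. below f e}) ` S"] \<open>S \<noteq> {}\<close> by auto
    then obtain e where e: "e \<in> S" "D = {f. below f e}" by auto
    have "below f e" if "f \<in> S" "below e f" for f
    proof -
      have "D \<subseteq> {g. below g f}" using that(2) e(2) below_trans by auto
      then have "D = {g. below g f}" using D(2) that(1) by blast
      then show ?thesis using e(2) below_refl by blast
    qed
    then show ?thesis using that[of e] e(1) by blast
  qed
  have em: "e \<in> meet_irr" using e S by (auto simp: closed_down_def)
  \<comment> \<open>Removing the class of \<open>e\<close> keeps the set closed, so
    \<open>\<theta>\<close> is the join of \<open>cg e\<close> and the strictly smaller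
    \<open>collapse T\<close>.\<close>
  define T where "T = {f \<in> S. \<not> below e f}"
  have T: "closed_down T"
    using S(1) below_trans under_below by (auto simp: closed_down_def T_def)
  have "is_join_in (Con TYPE('a)) (cg e) (collapse T) \<theta>"
    unfolding is_join_in_def
  proof (intro conjI ballI impI)
    show "\<theta> \<in> Con TYPE('a)" using con by (simp add: Con_def)
    show "cg e \<le> \<theta>" using cg_le_congruence[OF con] e by (simp add: S_def)
    show "collapse T \<le> \<theta>" unfolding S(2)[symmetric] by (rule collapse_mono) (auto simp: T_def)
    fix \<eta> assume \<eta>: "\<eta> \<in> Con TYPE('a)" "cg e \<le> \<eta> \<and> collapse T \<le> \<eta>"
    then have "collapsed (cg e) \<subseteq> collapsed \<eta>" "collapsed (collapse T) \<subseteq> collapsed \<eta>"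
      by (auto dest: collapsed_mono)
    moreover have "collapsed (cg e) = {f. below f e}" "collapsed (collapse T) = T"
      using collapsed_cg[OF em] collapsed_collapse[of T] T by (auto simp: closed_down_def)
    ultimately have "S \<subseteq> collapsed \<eta>" using e(2) unfolding T_def by blast
    then show "\<theta> \<le> \<eta>"
      using collapse_mono[of S "collapsed \<eta>"] collapse_collapsed[of \<eta>] \<eta>(1) S(2) by (simp add: Con_def)
  qed
  moreover have "collapse T \<in> Con TYPE('a)" using congruence_collapse[OF T] by (simp add: Con_def)
  ultimately have "\<theta> = cg e \<or> \<theta> = collapse T"
    using JD(3)[OF J cg_Con[OF em]] by blast
  moreover have "\<theta> \<noteq> collapse T"
  proof
    assume "\<theta> = collapse T"
    then have "S = T" using collapsed_collapse[of T] T by (auto simp: closed_down_def S_def)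
    moreover have "e \<notin> T" by (simp add: T_def)
    ultimately show False using e(1) by simp
  qed
  ultimately show "\<theta> \<in> cg ` meet_irr" using em by auto
next
  fix \<theta> assume "\<theta> \<in> cg ` meet_irr"
  then obtain e where e: "e \<in> meet_irr" "\<theta> = cg e" by auto
  note coll = collapsed_cg[OF e(1)]
  have "\<not> is_zero_in (Con TYPE('a)) (cg e)"
  proof
    assume z: "is_zero_in (Con TYPE('a)) (cg e)"
    have "closed_down {}" by (simp add: closed_down_def)
    then have "cg e \<le> collapse {}"
      using z congruence_collapse by (auto simp: is_zero_in_def Con_def)
    then have "collapsed (cg e) \<subseteq> {}" using collapsed_mono collapsed_collapse by (metis empty_subsetI)
    then have "e \<notin> {f. below f e}" using coll by blast
    then show False by simp
  qed
  moreover have "cg e = a \<or> cg e = b"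
    if ab: "a \<in> Con TYPE('a)" "b \<in> Con TYPE('a)" "is_join_in (Con TYPE('a)) a b (cg e)" for a b
  proof -
    have con: "lattice_congruence a" "lattice_congruence b" using ab by (auto simp: Con_def)
    let ?U = "collapsed a \<union> collapsed b"
    \<comment> \<open>A union of closed sets is closed, so the join of \<open>a\<close> and
      \<open>b\<close> collapses nothing beyond what they collapse.\<close>
    have U: "closed_down ?U" using closed_collapsed con by (fastforce simp: closed_down_def)
    have "a \<le> collapse ?U" "b \<le> collapse ?U"
      using collapse_collapsed con collapse_mono by (metis sup.cobounded1 sup.cobounded2)+
    then have "cg e \<le> collapse ?U"
      using ab(3) congruence_collapse[OF U] by (auto simp: is_join_in_def Con_def)
    then have "collapsed (cg e) \<subseteq> ?U"
      using collapsed_mono collapsed_collapse U by (metis closed_down_def)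
    then have "e \<in> ?U" using coll by auto
    then have "cg e \<le> a \<or> cg e \<le> b" using cg_le_congruence con by blast
    then show ?thesis using ab(3) by (auto simp: is_join_in_def)
  qed
  ultimately show "\<theta> \<in> J (Con TYPE('a))" using cg_Con[OF e(1)] unfolding J_def e(2) by blast
qed

end

section \<open>The order of join-irreducible congruences\<close>

context grid
begin

text \<open>Distinct meet-irreducibles may generate the same congruence. Hence equality of
  congruences becomes \<open>equi\<close>, and covering and maximality are stated for the preorder
  \<open>below\<close>.\<close>

definition equi :: "'a \<Rightarrow> 'a \<Rightarrow> bool" where
  "equi a b \<longleftrightarrow> below a b \<and> below b a"

definition lower_cover :: "'a \<Rightarrow> 'a \<Rightarrow> bool" where
  "lower_cover a b \<longleftrightarrow> a \<in> meet_irr \<and> b \<in> meet_irr \<and> below a b \<and> \<not> below b a \<and>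
     (\<forall>g\<in>meet_irr. below a g \<longrightarrow> below g b \<longrightarrow> below g a \<or> below b g)"

definition maximal :: "'a \<Rightarrow> bool" where
  "maximal z \<longleftrightarrow> z \<in> meet_irr \<and> (\<forall>g\<in>meet_irr. below z g \<longrightarrow> below g z)"

end

lemma (in grid) mirror_simps2:
  "grid.equi j i a b \<longleftrightarrow> equi a b" "grid.lower_cover j i a b \<longleftrightarrow> lower_cover a b"
  "grid.maximal j i a \<longleftrightarrow> maximal a"
proof -
  interpret m: grid j i by (rule mirror)
  show "m.equi a b \<longleftrightarrow> equi a b" "m.lower_cover a b \<longleftrightarrow> lower_cover a b" "m.maximal a \<longleftrightarrow> maximal a"
    by (simp_all add: m.equi_def equi_def m.lower_cover_def lower_cover_def m.maximal_def maximal_def mirror_simps)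
qed

context grid
begin

lemma nw_not_less: "nw a b \<Longrightarrow> \<not> a < b" "nw a b \<Longrightarrow> \<not> b < a" "nw a b \<Longrightarrow> \<not> nw b a"
  using lessD[of a b] lessD[of b a] by (auto simp: nw_def)

lemma nw_trans: "nw a b \<Longrightarrow> nw b c \<Longrightarrow> nw a c"
  by (auto simp: nw_def)

lemma internalI: "nw a e \<Longrightarrow> nw e b \<Longrightarrow> a \<in> meet_irr \<Longrightarrow> e \<in> meet_irr \<Longrightarrow> b \<in> meet_irr \<Longrightarrow> internal e"
  by (auto simp: internal_def)

lemma underD:
  assumes "under e m"
  shows "internal e" "e \<in> meet_irr" "m \<in> meet_irr" "up m \<subseteq> up e" "nw m e \<or> nw e m"
  using assms by (auto simp: under_def internal_def)

lemma up_mono: "below a b \<Longrightarrow> up b \<subseteq> up a"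
  unfolding below_def by (induction rule: rtranclp_induct) (auto simp: under_def)

lemma below_internal: "below a b \<Longrightarrow> a = b \<or> internal a"
  unfolding below_def by (induction rule: converse_rtranclp_induct) (auto simp: under_def)

lemma equi_sym: "equi a b \<Longrightarrow> equi b a"
  by (auto simp: equi_def)

lemma equi_trans: "equi a b \<Longrightarrow> equi b c \<Longrightarrow> equi a c"
  by (auto simp: equi_def intro: below_trans)

lemma equi_up: "equi a b \<Longrightarrow> up a = up b"
  using up_mono by (auto simp: equi_def)

lemma equi_internal: "equi a b \<Longrightarrow> a = b \<or> internal a \<and> internal b"
  using below_internal by (auto simp: equi_def)

text \<open>Equal \<open>up\<close> sets rule out strict comparability, so distinct \<open>a\<close>
  and \<open>b\<close> are under each other.\<close>

lemma equiI:
  assumes "internal a" "internal b" "up a = up b"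
  shows "equi a b"
proof -
  have mi: "a \<in> meet_irr" "b \<in> meet_irr" using assms by (auto simp: internal_def)
  have "a = b \<or> nw a b \<or> nw b a"
    using meet_irr_cases[OF mi] assms(3) mi by (auto simp: up_def)
  then consider "a = b" | "under a b" "under b a"
    using assms mi by (auto simp: under_def)
  then show ?thesis by cases (auto simp: equi_def under_below)
qed

text \<open>Whatever lies above both \<open>e\<close> and \<open>e'\<close> exceeds \<open>m\<close>
  in both coordinates.\<close>

lemma under_between:
  assumes "nw e' m" "nw m e" "equi e e'" "under e m" "internal e'"
  shows "equi e m"
proof (rule equiI)
  have mi: "e \<in> meet_irr" "m \<in> meet_irr" "e' \<in> meet_irr"
    using assms by (auto simp: under_def internal_def)
  show "internal e" using assms by (auto dest: underD)
  show "internal m" using assms mi internalI by blast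
  have "f \<in> up m" if "f \<in> up e" for f
  proof -
    have "f \<in> meet_irr" "e < f" "e' < f" using that equi_up[OF assms(3)] by (auto simp: up_def)
    then show ?thesis
      using assms mi by (auto simp: up_def meet_irr_less_iff nw_def)
  qed
  then show "up e = up m" using assms(4) by (auto simp: under_def)
qed

text \<open>A whole class has \<open>m\<close> on one side: comparability with \<open>m\<close>
  contradicts the equality of \<open>up\<close> sets, and an \<open>m\<close> in between would be
  equivalent to \<open>e\<close>.\<close>

lemma same_side:
  assumes "under e m" "nw m e" "equi e e'" "\<not> below m e"
  shows "under e' m" "nw m e'"
proof -
  have mi: "e \<in> meet_irr" "m \<in> meet_irr" "internal e" "up m \<subseteq> up e" using assms by (auto dest: underD)
  then have int: "internal e'" using equi_internal[OF assms(3)] by auto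
  then have mi': "e' \<in> meet_irr" by (auto simp: internal_def)
  have "m \<noteq> e'" using assms(3,4) by (auto simp: equi_def)
  moreover have "\<not> e' < m"
    using equi_up[OF assms(3)] mi mi' nw_not_less[OF assms(2)] by (auto simp: up_def)
  moreover have "\<not> m < e'"
    using equi_up[OF assms(3)] mi mi' by (auto simp: up_def)
  moreover have "\<not> nw e' m"
    using under_between[OF _ assms(2,3,1) int] assms(4) by (auto simp: equi_def)
  ultimately show "nw m e'" using meet_irr_cases[OF mi(2) mi'] by auto
  then show "under e' m"
    using int mi equi_up[OF assms(3)] by (auto simp: under_def)
qed

end

context grid
begin

interpretation m: grid j i by (rule mirror)

lemma same_side_iff:
  assumes "under e m" "equi e e'" "\<not> below m e"
  shows "under e' m" "nw m e' \<longleftrightarrow> nw m e" "nw e' m \<longleftrightarrow> nw e m"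
  using same_side[OF assms(1) _ assms(2,3)] m.same_side[of e m e'] assms underD(5)[OF assms(1)]
    nw_not_less(3)
  by (auto simp: mirror_simps mirror_simps2)

text \<open>On a path of \<open>under\<close> steps from \<open>e\<close> to \<open>m\<close>, take
  the step leaving the class of \<open>e\<close>. Its target is equivalent to \<open>m\<close> by
  the covering condition, and \<open>same_side_iff\<close> replaces its source by
  \<open>e\<close>.\<close>

lemma lower_cover_under:
  assumes "lower_cover e m"
  obtains m' where "equi m' m" "under e m'" "\<not> below m' e"
proof -
  have "\<exists>e' m'. equi e' e \<and> under e' m' \<and> \<not> below m' e \<and> below m' m" if "below e m" "\<not> below m e"
    using that(1)[unfolded below_def] that(2)
  proof (induction rule: converse_rtranclp_induct)
    case (step a b)
    show ?case
    proof (cases "below b a")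
      case True
      then have eq: "equi b a" using step by (auto simp: equi_def intro: under_below)
      have "\<not> below m b" using True step.prems below_trans by blast
      then obtain e' m' where "equi e' b" "under e' m'" "\<not> below m' b" "below m' m"
        using step.IH by blast
      then show ?thesis using eq equi_trans below_trans by (metis equi_def)
    next
      case False
      have "equi a a" by (auto simp: equi_def)
      then show ?thesis using False step by (auto simp: below_def)
    qed
  qed (auto simp: below_def)
  then obtain e' m' where em: "equi e' e" "under e' m'" "\<not> below m' e" "below m' m"
    using assms by (auto simp: lower_cover_def)
  have "below e m'" using em under_below below_trans by (metis equi_def)
  then have "equi m' m"
    using assms em underD[OF em(2)] by (auto simp: lower_cover_def equi_def)
  moreover have "\<not> below m' e'" using em below_trans by (metis equi_def)
  then have "under e m'"
    using same_side_iff[OF em(2,1)] by blast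
  ultimately show ?thesis using that em by blast
qed

text \<open>An element above \<open>m\<close> is above \<open>p\<close> too; being beyond
  \<open>p\<close> in \<open>i\<close> and beyond \<open>m\<close> in \<open>j\<close>, it is above
  \<open>m'\<close>.\<close>

lemma under_chain:
  assumes "under p m" "under p m'" "nw m p" "nw m' p" "nw m m'"
  shows "under m' m"
proof -
  note mi = underD[OF assms(1)] underD[OF assms(2)]
  have "internal m'" using internalI[OF assms(5,4)] mi by auto
  moreover have "f \<in> up m'" if "f \<in> up m" for f
  proof -
    have "f \<in> up p" "f \<in> meet_irr" using that mi by (auto simp: up_def)
    then show ?thesis using that assms mi by (auto simp: up_def meet_irr_less_iff nw_def)
  qed
  ultimately show ?thesis using assms mi by (auto simp: under_def)
qed

lemma under_same_side:
  assumes "under p m" "under p m'" "nw m p" "nw m' p"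
  shows "below m m' \<or> below m' m"
proof -
  note mi = underD[OF assms(1)] underD[OF assms(2)]
  have "m = m' \<or> nw m m' \<or> nw m' m"
    using meet_irr_cases[of m m'] mi nw_not_less[OF assms(3)] nw_not_less[OF assms(4)]
    by (auto simp: up_def)
  then show ?thesis
    using under_chain[OF assms] under_chain[OF assms(2,1,4,3)] under_below by auto
qed

end

context grid
begin

interpretation m: grid j i by (rule mirror)

text \<open>By \<open>under_same_side\<close>, elements on one side of \<open>p\<close> that
  \<open>p\<close> is under are comparable by \<open>below\<close>; inequivalent covers are
  not.\<close>

lemma lower_covers_opposite:
  assumes "lower_cover p x" "lower_cover p y" "\<not> equi x y"
  obtains a b where "equi a x" "equi b y" "under p a" "under p b" "\<not> below a p" "\<not> below b p"
    "nw a p \<and> nw p b \<or> nw b p \<and> nw p a"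
proof -
  obtain a where a: "equi a x" "under p a" "\<not> below a p" using lower_cover_under assms(1) by blast
  obtain b where b: "equi b y" "under p b" "\<not> below b p" using lower_cover_under assms(2) by blast
  have "\<not> (below a b \<or> below b a)"
  proof
    assume "below a b \<or> below b a"
    then have "below x y \<or> below y x" using a b below_trans unfolding equi_def by metis
    then show False using assms by (auto simp: lower_cover_def equi_def)
  qed
  then have "\<not> (nw a p \<and> nw b p)" "\<not> (nw p a \<and> nw p b)"
    using under_same_side[of p a b] m.under_same_side[of p a b] a b by (auto simp: mirror_simps)
  then show ?thesis using that[OF a(1) b(1) a(2) b(2) a(3) b(3)] underD(5)[OF a(2)] underD(5)[OF b(2)]
    by auto
qed

text \<open>A highest element north-west of \<open>e\<close> has nothing north-west of itself, so it
  is not internal and cannot be below \<open>e\<close>.\<close>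

lemma under_maximal_of_internal:
  assumes "internal e"
  obtains m where "under e m" "\<not> below m e"
proof -
  let ?A = "{a \<in> meet_irr. nw a e}"
  have fin: "finite ?A" and "?A \<noteq> {}" using assms by (auto simp: internal_def)
  then have "Max (j ` ?A) \<in> j ` ?A" by (intro Max_in) auto
  then obtain m where m: "m \<in> ?A" "Max (j ` ?A) = j m" by auto
  have max: "j a \<le> j m" if "a \<in> ?A" for a
    unfolding m(2)[symmetric] using that fin by (intro Max_ge) auto
  have "under e m"
    using under_maximal_nw[OF assms, of m] m(1) max meet_irr_less_iff[of m]
    by (metis (mono_tags, lifting) mem_Collect_eq linorder_not_le)
  moreover have "\<not> nw a m" if "a \<in> meet_irr" for a
    using that m(1) max[of a] nw_trans[of a m e] by (auto simp: nw_def)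
  then have "\<not> internal m" by (auto simp: internal_def)
  then have "\<not> below m e" using below_internal[of m e] m nw_not_less(3)[of m e] by auto
  ultimately show ?thesis using that by blast
qed

lemma maximal_not_internal: "maximal z \<Longrightarrow> \<not> internal z"
  using under_maximal_of_internal under_below underD(3) unfolding maximal_def by metis

text \<open>Classes with several members consist of internal elements.\<close>

lemma equi_maximal: "maximal z \<Longrightarrow> equi a z \<Longrightarrow> a = z"
  using maximal_not_internal equi_internal by blast

lemma lower_cover_maximal:
  assumes "lower_cover x z" "maximal z"
  shows "under x z"
  using lower_cover_under[OF assms(1)] equi_maximal[OF assms(2)] by metis

text \<open>An \<open>n\<close> north-west of \<open>m'\<close> and above \<open>m\<close> lies
  between \<open>m'\<close> and \<open>z\<close> in the order \<open>below\<close>, so the covering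
  condition makes it equivalent to \<open>m'\<close>.\<close>

lemma marriage_aux:
  assumes "under m z" "under m' z" "\<not> internal z" "nw z m" "nw z m'" "nw m p" "nw p m'"
    and "\<not> below m m'" and cov: "\<And>g. g \<in> meet_irr \<Longrightarrow> below m' g \<Longrightarrow> below g z \<Longrightarrow> below g m' \<or> below z g"
  shows False
proof -
  note mi = underD[OF assms(1)] underD[OF assms(2)]
  have mm': "nw m m'" using assms nw_trans by blast
  obtain n where n: "under m' n" "nw n m'" "m \<le> n" "n \<in> meet_irr"
    using ex_under_nw[OF mi(6,2) mm'] .
  have "\<not> z < n" using n(2,4) mi(9) nw_not_less[of n m'] by (auto simp: up_def)
  moreover have "i z < i n" using n(3) assms(4) by (auto simp: le_iff nw_def)
  ultimately have zn: "nw z n"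
    using meet_irr_cases[OF mi(3) n(4)] meet_irr_less_iff[OF n(4) mi(3)] by (auto simp: nw_def)
  have "under n z" by (rule under_chain[OF assms(2) n(1) assms(5) n(2) zn])
  then have "below n m' \<or> below z n" using cov n(1,4) under_below by blast
  moreover have "\<not> below z n"
    using below_internal[of z n] assms(3) zn by (auto simp: nw_def)
  ultimately have eq: "up n = up m'" using n(1) under_below equi_up[of n m'] by (auto simp: equi_def)
  \<comment> \<open>\<open>n\<close> and \<open>m'\<close> have the same upper set, so anything above \<open>m'\<close> is above \<open>m\<close>.\<close>
  have "under m m'"
  proof (rule m.under_maximal_nw[unfolded mirror_simps])
    fix a assume a: "a \<in> meet_irr" "nw m a"
    show "\<not> m' < a"
    proof
      assume "m' < a"
      then have "n < a" using a eq by (auto simp: up_def)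
      then show False using n(3) nw_not_less[OF a(2)] by auto
    qed
  qed (use mi mm' in auto)
  then show False using assms(8) under_below by blast
qed

lemma marriage_left:
  assumes "maximal z" "lower_cover x z" "lower_cover y z" "\<not> equi x y"
    "lower_cover p x" "lower_cover p y" "nw z x"
  shows False
proof -
  have z: "\<not> internal z" "z \<in> meet_irr" using assms(1) maximal_not_internal by (auto simp: maximal_def)
  have u: "under x z" "under y z" using assms lower_cover_maximal by auto
  have nb: "\<not> below z x" "\<not> below z y" using assms by (auto simp: lower_cover_def)
  \<comment> \<open>Otherwise \<open>z\<close> would lie between \<open>y\<close> and
    \<open>x\<close> and be internal.\<close>
  have zy: "nw z y" using underD[OF u(2)] underD[OF u(1)] z internalI[of y z x] assms(7) by blast
  obtain a b where ab: "equi a x" "equi b y" "under p a" "under p b" "nw a p \<and> nw p b \<or> nw b p \<and> nw p a"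
    using lower_covers_opposite[OF assms(5,6,4)] by metis
  have a: "under a z" "nw z a"
    using same_side_iff[OF u(1) equi_sym[OF ab(1)] nb(1)] assms(7) by auto
  have b: "under b z" "nw z b"
    using same_side_iff[OF u(2) equi_sym[OF ab(2)] nb(2)] zy by auto
  have ca: "below g a \<or> below z g" if "g \<in> meet_irr" "below a g" "below g z" for g
    using assms(2) ab(1) that below_trans unfolding lower_cover_def equi_def by metis
  have cb: "below g b \<or> below z g" if "g \<in> meet_irr" "below b g" "below g z" for g
    using assms(3) ab(2) that below_trans unfolding lower_cover_def equi_def by metis
  have "\<not> below x y"
    using assms(2,3,4) nb underD(2)[OF u(2)] by (auto simp: lower_cover_def equi_def)
  moreover have "\<not> below y x"
    using assms(2,3,4) nb underD(2)[OF u(1)] by (auto simp: lower_cover_def equi_def)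
  ultimately have nab: "\<not> below a b" "\<not> below b a"
    using ab below_trans unfolding equi_def by metis+
  show False
    using ab(5) marriage_aux[OF a(1) b(1) z(1) a(2) b(2) _ _ nab(1) cb]
      marriage_aux[OF b(1) a(1) z(1) b(2) a(2) _ _ nab(2) ca] by blast
qed

end

context grid
begin

interpretation m: grid j i by (rule mirror)

lemma marriage:
  assumes "maximal z" "lower_cover x z" "lower_cover y z" "\<not> equi x y"
    "lower_cover p x" "lower_cover p y"
  shows False
  using marriage_left[OF assms] m.marriage_left[of z x y p] assms
    underD(5)[OF lower_cover_maximal[OF assms(2,1)]]
  by (auto simp: mirror_simps mirror_simps2)

section \<open>The two-pendant four-crown in the grid\<close>

lemma crown_less:
  assumes "under e a" "under e b" "under f c" "under f d"
    "nw a e" "nw e b" "nw c f" "nw f d" "a < c" "b < d"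
  shows "e < f"
proof -
  note mi = underD[OF assms(1)] underD[OF assms(2)] underD[OF assms(3)] underD[OF assms(4)]
  have "e < c" "e < d" using mi assms by (auto simp: up_def)
  \<comment> \<open>The comparison with \<open>c\<close> settles the coordinate \<open>i\<close>,
    the one with \<open>d\<close> settles \<open>j\<close>.\<close>
  then show ?thesis using assms mi by (auto simp: meet_irr_less_iff nw_def)
qed

text \<open>Representatives of \<open>x\<close> and \<open>y\<close> are comparable by
  \<open>crown_less\<close>, yet lie on opposite sides of \<open>z\<close>.\<close>

lemma crown_aux:
  assumes "lower_cover x a" "lower_cover x b" "lower_cover y c" "lower_cover y d"
    "maximal a" "maximal b" "maximal c" "maximal d"
    "nw a x" "nw x b" "nw c y" "nw y d" "a < c" "b < d"
    "lower_cover z x" "lower_cover z y" "\<not> equi x y"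
  shows False
proof -
  have u: "under x a" "under x b" "under y c" "under y d"
    using assms lower_cover_maximal by auto
  have nb: "\<not> below a x" "\<not> below b x" "\<not> below c y" "\<not> below d y"
    using assms by (auto simp: lower_cover_def)
  obtain e f where ef: "equi e x" "equi f y" "under z e" "under z f" "nw e z \<and> nw z f \<or> nw f z \<and> nw z e"
    using lower_covers_opposite[OF assms(15-17)] by metis
  note e = equi_sym[OF ef(1)] and f = equi_sym[OF ef(2)]
  have "e < f"
  proof (rule crown_less)
    show "under e a" "nw a e" using same_side_iff[OF u(1) e nb(1)] assms(9) by simp_all
    show "under e b" "nw e b" using same_side_iff[OF u(2) e nb(2)] assms(10) by simp_all
    show "under f c" "nw c f" using same_side_iff[OF u(3) f nb(3)] assms(11) by simp_all
    show "under f d" "nw f d" using same_side_iff[OF u(4) f nb(4)] assms(12) by simp_all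
  qed fact+
  then show False using ef(5) nw_trans nw_not_less by blast
qed

text \<open>Around the crown each maximal element keeps its side, not being internal:
  \<open>a\<close> and \<open>c\<close> stay on the north-west border, \<open>b\<close> and
  \<open>d\<close> on the south-east one.\<close>

lemma crown_left:
  assumes lc: "lower_cover x a" "lower_cover x b" "lower_cover u b" "lower_cover u c"
    "lower_cover y c" "lower_cover y d" "lower_cover v d" "lower_cover v a"
    "lower_cover z x" "lower_cover z y" "lower_cover w u" "lower_cover w v"
    and max: "maximal a" "maximal b" "maximal c" "maximal d"
    and ne: "a \<noteq> b" "b \<noteq> c" "c \<noteq> d" "d \<noteq> a" "a \<noteq> c" "b \<noteq> d" "\<not> equi x y" "\<not> equi u v"
    and left: "nw a x"
  shows False
proof -
  note int = max[THEN maximal_not_internal]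
  have mi: "a \<in> meet_irr" "b \<in> meet_irr" "c \<in> meet_irr" "d \<in> meet_irr"
    "x \<in> meet_irr" "y \<in> meet_irr" "u \<in> meet_irr" "v \<in> meet_irr"
    using max lc by (auto simp: maximal_def lower_cover_def)
  have opp: "nw s e \<and> nw e t \<or> nw t e \<and> nw e s"
    if st: "lower_cover e s" "lower_cover e t" "maximal s" "maximal t" "s \<noteq> t" for e s t
  proof -
    have "\<not> equi s t" using st equi_maximal by blast
    then show ?thesis
      using lower_covers_opposite[OF st(1,2)] equi_maximal st by metis
  qed
  have x: "nw x b" using opp[OF lc(1,2) max(1,2) ne(1)] left nw_not_less by blast
  have u: "nw u b" "nw c u"
    using opp[OF lc(3,4) max(2,3) ne(2)] x mi int internalI[of x b u] by blast+
  have y: "nw c y" "nw y d"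
    using opp[OF lc(5,6) max(3,4) ne(3)] u mi int internalI[of y c u] by blast+
  have v: "nw v d" "nw a v"
    using opp[OF lc(7,8) max(4,1) ne(4)] y mi int internalI[of y d v] by blast+
  \<comment> \<open>Two incomparable elements of one border would make the inner one
    internal.\<close>
  have "a < c \<or> c < a"
    using meet_irr_cases[of a c] internalI[of a c u] internalI[of c a x] left u mi int ne by blast
  moreover have "b < d \<or> d < b"
    using meet_irr_cases[of b d] internalI[of x b d] internalI[of y d b] x y mi int ne by blast
  \<comment> \<open>If the two borders are ordered alike, the pendant \<open>z\<close> gives the
    contradiction; if oppositely, the pendant \<open>w\<close>.\<close>
  ultimately show False
    using crown_aux[OF lc(1,2,5,6) max(1,2,3,4) left x y _ _ lc(9,10) ne(7)]
      crown_aux[OF lc(5,6,1,2) max(3,4,1,2) y left x _ _ lc(10,9)]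
      crown_aux[OF lc(4,3,8,7) max(3,2,1,4) u(2,1) v(2,1) _ _ lc(11,12) ne(8)]
      crown_aux[OF lc(8,7,4,3) max(1,4,3,2) v(2,1) u(2,1) _ _ lc(12,11)]
      ne equi_sym by blast
qed

end

context grid
begin

interpretation m: grid j i by (rule mirror)

lemma crown:
  assumes lc: "lower_cover x a" "lower_cover x b" "lower_cover u b" "lower_cover u c"
    "lower_cover y c" "lower_cover y d" "lower_cover v d" "lower_cover v a"
    "lower_cover z x" "lower_cover z y" "lower_cover w u" "lower_cover w v"
    and max: "maximal a" "maximal b" "maximal c" "maximal d"
    and ne: "a \<noteq> b" "b \<noteq> c" "c \<noteq> d" "d \<noteq> a" "a \<noteq> c" "b \<noteq> d" "\<not> equi x y" "\<not> equi u v"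
  shows False
  using crown_left[OF assms] m.crown_left[of x a b u c y d v z w] assms
    underD(5)[OF lower_cover_maximal[OF lc(1) max(1)]]
  by (auto simp: mirror_simps mirror_simps2)

section \<open>Transfer to the poset of join-irreducible congruences\<close>

lemma cg_eq_iff: "e \<in> meet_irr \<Longrightarrow> f \<in> meet_irr \<Longrightarrow> cg e = cg f \<longleftrightarrow> equi e f"
  using cg_le_iff by (metis equi_def order.antisym order_refl)

lemma covers_J_Con:
  assumes "e \<in> meet_irr" "f \<in> meet_irr"
  shows "covers_in (J (Con TYPE('a))) (cg e) (cg f) \<longleftrightarrow> lower_cover e f"
  using assms unfolding J_Con covers_in_def lower_cover_def less_le_not_le
  by (auto simp: cg_le_iff)

lemma Max_J_Con:
  assumes "e \<in> meet_irr" "cg e \<in> Max_elems (J (Con TYPE('a)))"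
  shows "maximal e"
  unfolding maximal_def
proof (intro conjI ballI impI)
  fix g assume g: "g \<in> meet_irr" "below e g"
  then have "cg e \<le> cg g" using assms(1) cg_le_iff by blast
  moreover have "\<not> cg e < cg g" using assms(2) g(1) unfolding J_Con Max_elems_def by blast
  ultimately have "cg g \<le> cg e" by auto
  then show "below g e" using g(1) assms(1) cg_le_iff by blast
qed fact

lemma forbidden_marriage: "forbidden_marriage_property (Con TYPE('a))"
  unfolding forbidden_marriage_property_def
proof (intro ballI impI notI)
  fix X Y Z
  assume J: "X \<in> J (Con TYPE('a))" "Y \<in> J (Con TYPE('a))" "Z \<in> Max_elems (J (Con TYPE('a)))"
    and c: "X \<noteq> Y \<and> covers_in (J (Con TYPE('a))) X Z \<and> covers_in (J (Con TYPE('a))) Y Z"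
    and "\<exists>P\<in>J (Con TYPE('a)). covers_in (J (Con TYPE('a))) P X \<and> covers_in (J (Con TYPE('a))) P Y"
  then obtain P where P: "P \<in> J (Con TYPE('a))"
    "covers_in (J (Con TYPE('a))) P X" "covers_in (J (Con TYPE('a))) P Y" by blast
  have "Z \<in> J (Con TYPE('a))" using J by (auto simp: Max_elems_def)
  then obtain x y z p where xyzp: "x \<in> meet_irr" "X = cg x" "y \<in> meet_irr" "Y = cg y"
      "z \<in> meet_irr" "Z = cg z" "p \<in> meet_irr" "P = cg p"
    using J P unfolding J_Con by blast
  then show False
    using marriage[of z x y p] Max_J_Con covers_J_Con cg_eq_iff J c P by blast
qed

lemma two_pendant_four_crown: "two_pendant_four_crown_property (Con TYPE('a))"
  unfolding two_pendant_four_crown_property_def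
proof (intro notI)
  let ?J = "J (Con TYPE('a))"
  assume "\<exists>X. cover_preserving_subposet X ?J \<and>
    (\<exists>f :: R \<Rightarrow> ('a \<times> 'a) set. poset_iso f UNIV X) \<and> Max_elems X \<subseteq> Max_elems ?J"
  then obtain X and f :: "R \<Rightarrow> ('a \<times> 'a) set" where
    X: "cover_preserving_subposet X ?J" "poset_iso f UNIV X" "Max_elems X \<subseteq> Max_elems ?J"
    by blast
  have f: "inj f" "range f = X" "\<And>p q. p \<le> q \<longleftrightarrow> f p \<le> f q"
    using X(2) by (auto simp: poset_iso_def bij_betw_def)
  then have less: "p < q \<longleftrightarrow> f p < f q" for p q by (simp add: less_le_not_le)
  have "covers_in X (f p) (f q)" if "(p, q) \<in> R_edges" for p q
    using that unfolding R_covers_iff[symmetric] covers_in_def f(2)[symmetric] by (auto simp: less)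
  then have cov: "covers_in ?J (f p) (f q)" if "(p, q) \<in> R_edges" for p q
    using X(1) f(2) that unfolding cover_preserving_subposet_def by blast
  have max: "f p \<in> Max_elems ?J" if "R_height p = 2" for p
  proof -
    have "\<not> p < q" for q using R_less_height[of p q] that by (cases q) auto
    then have "f p \<in> Max_elems X" using f(2) less by (auto simp: Max_elems_def)
    then show ?thesis using X(3) by blast
  qed
  have "\<forall>p. \<exists>e\<in>meet_irr. f p = cg e"
    using X(1) f(2) unfolding cover_preserving_subposet_def J_Con by blast
  then obtain g where g: "\<And>p. g p \<in> meet_irr" "\<And>p. f p = cg (g p)" by metis
  have lc: "lower_cover (g p) (g q)" if "(p, q) \<in> R_edges" for p q
    using cov[OF that] covers_J_Con g by auto
  have mx: "maximal (g p)" if "R_height p = 2" for p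
    using max[OF that] Max_J_Con g by auto
  have ne: "\<not> equi (g p) (g q)" if "p \<noteq> q" for p q
    using f(1) that g cg_eq_iff by (metis injD)
  then have ne': "g p \<noteq> g q" if "p \<noteq> q" for p q
    using that by (metis below_refl equi_def)
  show False
    by (rule crown[of "g R_x" "g R_a" "g R_b" "g R_u" "g R_c" "g R_y" "g R_d" "g R_v" "g R_z" "g R_w"])
      (auto intro!: lc mx ne ne' simp: R_edges_def)
qed

end

theorem theorem4p3:
  assumes "planar_lattice TYPE('a::{finite,lattice})"
    and "semimodular TYPE('a)"
    and "slim TYPE('a)"
  shows "forbidden_marriage_property (Con TYPE('a)) \<and>
         two_pendant_four_crown_property (Con TYPE('a))"
proof -
  obtain l r :: "'a \<Rightarrow> 'a" where "left_right l r" using ex_left_right[OF assms] .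
  then interpret grid "rank (orbit l)" "rank (orbit r)" by (rule left_right.grid)
  show ?thesis using forbidden_marriage two_pendant_four_crown by blast
qed

end
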